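(* Let $q=2^{2k+1}$ with $k\ge 1$ an integer, and let $\pi$ be a (nontrivial) character of order $3$ of the unit circle $C\subset\mathbb{L}$. Then the line system $\mathcal{L}_\pi$ is $(q-1)$-dimensional (it is a system of lines in the $(q-1)$-dimensional real Hilbert space $H(\mathbb{F}_q^* )$) and $|\mathcal{L}_\pi|=q^2-1$. Additionally, $\mathcal{L}_\pi$ is biangular with angle set $\mathcal{A}_{\mathcal{L}_\pi}=\{0,\sqrt{2/q}\}$.
   Context: Let $\mathbb{F}_q$ be the field with $q$ elements, $q$ a power of $2$, and $\mathbb{L}/\mathbb{F}_q$ its quadratic extension. For $z\in\mathbb{L}$ put $N(z)=z^{q+1}$ and $S(z)=z+z^q$ (relative norm and trace to $\mathbb{F}_q$); in particular $N(x)=x^2$ for $x\in\mathbb{F}_q$. The unit circle is $C=\{t\in\mathbb{L}: N(t)=1\}$, a cyclic subgroup of $\mathbb{L}^*$ of order $q+1$. Characters of $C$ are homomorphisms $C\to\mathbb{C}\setminus\{0\}$; the order of a character is the least positive integer $k$ for which its $k$-th power is trivial. Let $\chi(x)=(-1)^{\mathrm{Tr}(x)}$ for $x\in\mathbb{F}_q$, where $\mathrm{Tr}:\mathbb{F}_q\to\mathbb{F}_2$ is the absolute trace. The Bessel function of $\mathbb{L}$ attached to $\pi$ is $J_\pi(z)=\frac1q\sum_{t\in C}\chi(-S(tz))\pi(t)$ for $z\in\mathbb{L}$. For $c\in\mathbb{F}_q$ put $J_{\pi,c}(x)=J_\pi(cx)$ and $\chi_c(x)=\chi(cN(x))$ for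 $x\in\mathbb{F}_q$. For $y\in\mathbb{F}_q^*$ let $\delta_y$ be the function on $\mathbb{F}_q^*$ equal to $1$ at $y$ and $0$ elsewhere. $H(\mathbb{F}_q^* )$ is the Hilbert space of real functions on $\mathbb{F}_q^*$ with $\langle f,g\rangle=\sum_{x\in\mathbb{F}_q^*}f(x)g(x)$. (For $q$ even and $\pi$ nontrivial, $J_\pi$ is real-valued on $\mathbb{F}_q^*$ and has norm $1$.) The line system $\mathcal{L}_\pi$ is the set of lines spanned by the unit vectors in $$\Phi_\pi=\{\chi_aJ_{\pi,y}\mid a\in\mathbb{F}_q,\ y\in\mathbb{F}_q^*\}\cup\{\delta_y\mid y\in\mathbb{F}_q^*\}\subset H(\mathbb{F}_q^* ).$$ For a set $\mathcal{L}$ of lines, each line being represented by one unit vector, the angle set $\mathcal{A}_{\mathcal{L}}$ is the set of values $|\langle x,y\rangle|$ over representatives $x,y$ of distinct lines of $\mathcal{L}$; $\mathcal{L}$ is biangular if $|\mathcal{A}_{\mathcal{L}}|=2$. *)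

theory Defs
  imports "HOL-Analysis.Analysis"
begin

text \<open>
  Throughout, \<open>'f\<close> is the finite field with \<open>q = CARD('f)\<close> elements, \<open>'l\<close> is its quadratic
  extension, and \<open>\<iota> :: 'f \<Rightarrow> 'l\<close> is the embedding.
\<close>

definition field_embedding :: "('f::field \<Rightarrow> 'l::field) \<Rightarrow> bool" where
  "field_embedding \<iota> \<longleftrightarrow>
     \<iota> 1 = 1 \<and> (\<forall>x y. \<iota> (x + y) = \<iota> x + \<iota> y) \<and> (\<forall>x y. \<iota> (x * y) = \<iota> x * \<iota> y)"

definition quadratic_extension :: "('f::field \<Rightarrow> 'l::field) \<Rightarrow> bool" where
  "quadratic_extension \<iota> \<longleftrightarrow>
     field_embedding \<iota> \<and> vector_space.dim (\<lambda>c z. \<iota> c * z) (UNIV :: 'l set) = 2"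

definition rel_norm :: "('f::finite_field \<Rightarrow> 'l::field) \<Rightarrow> 'l \<Rightarrow> 'l" where
  "rel_norm \<iota> z = z ^ (CARD('f) + 1)"

definition rel_trace :: "('f::finite_field \<Rightarrow> 'l::field) \<Rightarrow> 'l \<Rightarrow> 'l" where
  "rel_trace \<iota> z = z + z ^ CARD('f)"

definition unit_circle :: "('f::finite_field \<Rightarrow> 'l::field) \<Rightarrow> 'l set" where
  "unit_circle \<iota> = {t. rel_norm \<iota> t = 1}"

text \<open>
  For \<open>CARD('f) = 2 ^ n\<close> the summation range is \<open>{0, \<dots>, n - 1}\<close>, so this is the trace down to
  the prime field, which sits inside \<open>'f\<close> as \<open>{0, 1}\<close>.
\<close>

definition abs_trace :: "'f::finite_field \<Rightarrow> 'f" where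
  "abs_trace x = (\<Sum>i | 2 ^ i < CARD('f). x ^ (2 ^ i))"

definition add_char :: "'f::finite_field \<Rightarrow> real" where
  "add_char x = (if abs_trace x = 0 then 1 else - 1)"

text \<open>
  A character of the unit circle is represented by a function on \<open>'l\<close>; its values outside the
  circle are irrelevant.
\<close>

definition circle_character :: "('f::finite_field \<Rightarrow> 'l::field) \<Rightarrow> ('l \<Rightarrow> complex) \<Rightarrow> bool" where
  "circle_character \<iota> \<pi> \<longleftrightarrow>
     (\<forall>t\<in>unit_circle \<iota>. \<pi> t \<noteq> 0) \<and>
     (\<forall>s\<in>unit_circle \<iota>. \<forall>t\<in>unit_circle \<iota>. \<pi> (s * t) = \<pi> s * \<pi> t)"

definition character_order :: "('f::finite_field \<Rightarrow> 'l::field) \<Rightarrow> ('l \<Rightarrow> complex) \<Rightarrow> nat" where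
  "character_order \<iota> \<pi> = (LEAST k. 0 < k \<and> (\<forall>t\<in>unit_circle \<iota>. \<pi> t ^ k = 1))"

text \<open>
  Norms and traces lie in the image of \<open>\<iota>\<close> (lemmas \<open>rel_norm_range\<close> and \<open>rel_trace_range\<close>
  below); \<open>inv \<iota>\<close> turns them into elements of \<open>'f\<close>.
\<close>

definition bessel :: "('f::finite_field \<Rightarrow> 'l::field) \<Rightarrow> ('l \<Rightarrow> complex) \<Rightarrow> 'l \<Rightarrow> complex" where
  "bessel \<iota> \<pi> z =
     1 / of_nat CARD('f) *
       (\<Sum>t\<in>unit_circle \<iota>. complex_of_real (add_char (inv \<iota> (- rel_trace \<iota> (t * z)))) * \<pi> t)"

text \<open>
  The nonzero elements of \<open>'f\<close> as a type, so that \<open>real ^ 'f nonzero\<close> with its standard inner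
  product is the Hilbert space of real functions on the multiplicative group of \<open>'f\<close>.
\<close>

typedef (overloaded) 'a nonzero = "{x :: 'a :: zero_neq_one. x \<noteq> 0}"
  morphisms nonzero_val Abs_nonzero
  by (rule exI[of _ 1]) simp

instance nonzero :: ("{zero_neq_one,finite}") finite
proof
  have "inj (nonzero_val :: 'a nonzero \<Rightarrow> 'a)"
    by (simp add: inj_def nonzero_val_inject)
  then show "finite (UNIV :: 'a nonzero set)"
    by (rule finite_imageD[rotated]) simp
qed

text \<open>
  The vector of \<open>\<chi>\<^sub>a J\<^sub>\<pi>\<^sub>,\<^sub>y\<close>. The Bessel function takes real values at elements of \<open>'f\<close> (lemma
  \<open>bessel_real\<close> below), so taking the real part loses nothing.
\<close>

definition bessel_vec ::
    "('f::finite_field \<Rightarrow> 'l::field) \<Rightarrow> ('l \<Rightarrow> complex) \<Rightarrow> 'f \<Rightarrow> 'f nonzero \<Rightarrow> real ^ 'f nonzero" where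
  "bessel_vec \<iota> \<pi> a y =
     (\<chi> x. add_char (a * inv \<iota> (rel_norm \<iota> (\<iota> (nonzero_val x)))) *
           Re (bessel \<iota> \<pi> (\<iota> (nonzero_val y * nonzero_val x))))"

definition Phi ::
    "('f::finite_field \<Rightarrow> 'l::field) \<Rightarrow> ('l \<Rightarrow> complex) \<Rightarrow> (real ^ 'f nonzero) set" where
  "Phi \<iota> \<pi> = {bessel_vec \<iota> \<pi> a y | a y. True} \<union> {axis y 1 | y. True}"

definition line_system ::
    "('f::finite_field \<Rightarrow> 'l::field) \<Rightarrow> ('l \<Rightarrow> complex) \<Rightarrow> (real ^ 'f nonzero) set set" where
  "line_system \<iota> \<pi> = (\<lambda>v. span {v}) ` Phi \<iota> \<pi>"

definition is_line :: "'v::euclidean_space set \<Rightarrow> bool" where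
  "is_line l \<longleftrightarrow> subspace l \<and> dim l = 1"

text \<open>
  Each line has exactly two unit vectors, \<open>u\<close> and \<open>- u\<close>, so \<open>\<bar>u \<bullet> v\<bar>\<close> does not depend on the
  choice of representatives.
\<close>

definition angle_set :: "'v::euclidean_space set set \<Rightarrow> real set" where
  "angle_set L =
     {\<bar>u \<bullet> v\<bar> | u v l m. l \<in> L \<and> m \<in> L \<and> l \<noteq> m \<and>
        u \<in> l \<and> norm u = 1 \<and> v \<in> m \<and> norm v = 1}"

definition biangular :: "'v::euclidean_space set set \<Rightarrow> bool" where
  "biangular L \<longleftrightarrow> card (angle_set L) = 2"

lemma field_embedding_zero:
  assumes "field_embedding \<iota>"
  shows "\<iota> 0 = 0"
proof -
  have "\<iota> (0 + 0) = \<iota> 0 + \<iota> 0"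
    using assms unfolding field_embedding_def by blast
  then show ?thesis by (simp only: add_0_right) (metis add_cancel_left_right)
qed

lemma field_embedding_inj:
  assumes "field_embedding \<iota>"
  shows "inj \<iota>"
proof (rule injI)
  fix x y assume eq: "\<iota> x = \<iota> y"
  have "\<iota> ((x - y) + y) = \<iota> (x - y) + \<iota> y"
    using assms unfolding field_embedding_def by blast
  with eq have zero: "\<iota> (x - y) = 0" by simp
  show "x = y"
  proof (rule ccontr)
    assume "x \<noteq> y"
    then have "(x - y) * inverse (x - y) = 1" by simp
    moreover have "\<iota> ((x - y) * inverse (x - y)) = \<iota> (x - y) * \<iota> (inverse (x - y))"
      using assms unfolding field_embedding_def by blast
    ultimately have "\<iota> 1 = 0" using zero by simp
    then show False using assms by (simp add: field_embedding_def)
  qed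
qed

lemma field_embedding_power:
  assumes "field_embedding \<iota>"
  shows "\<iota> (x ^ n) = \<iota> x ^ n"
  using assms by (induction n) (auto simp: field_embedding_def)

lemma field_embedding_power_card:
  fixes \<iota> :: "'f::finite_field \<Rightarrow> 'l::field"
  assumes "field_embedding \<iota>"
  shows "\<iota> x ^ CARD('f) = \<iota> x"
  using field_embedding_power[OF assms, of x "CARD('f)"] by (simp add: finite_field_power_card_eq_same)

lemma field_embedding_range:
  fixes \<iota> :: "'f::finite_field \<Rightarrow> 'l::field"
  assumes "field_embedding \<iota>" and "z ^ CARD('f) = z"
  shows "z \<in> range \<iota>"
proof -
  let ?p = "monom 1 CARD('f) - monom 1 1 :: 'l poly"
  have "card (UNIV :: 'f set) \<ge> card {0, 1 :: 'f}"
    by (rule card_mono) auto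
  then have gt1: "CARD('f) > 1" by simp
  then have "coeff ?p CARD('f) = 1" by simp
  then have nz: "?p \<noteq> 0" by (metis coeff_0 zero_neq_one)
  have deg: "degree ?p \<le> CARD('f)"
    by (rule degree_diff_le) (use gt1 in \<open>auto simp: degree_monom_eq\<close>)
  have roots: "poly ?p w = 0 \<longleftrightarrow> w ^ CARD('f) = w" for w
    by (simp add: poly_monom)
  have sub: "range \<iota> \<subseteq> {w. poly ?p w = 0}"
    using field_embedding_power_card[OF assms(1)] by (auto simp only: roots mem_Collect_eq)
  have "card {w. poly ?p w = 0} \<le> CARD('f)"
    using card_poly_roots_bound[OF nz] deg by linarith
  also have "CARD('f) = card (range \<iota>)"
    using card_image[OF field_embedding_inj[OF assms(1)]] by simp
  finally have "range \<iota> = {w. poly ?p w = 0}"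
    by (intro card_seteq sub poly_roots_finite nz)
  then show ?thesis using assms(2) roots by auto
qed

lemma quadratic_extension_card:
  fixes \<iota> :: "'f::finite_field \<Rightarrow> 'l::field"
  assumes "quadratic_extension \<iota>"
  shows "CARD('l) = CARD('f) ^ 2"
proof -
  have emb: "field_embedding \<iota>"
    using assms by (simp add: quadratic_extension_def)
  interpret V: vector_space "\<lambda>c z. \<iota> c * z"
    using emb by unfold_locales (auto simp: field_embedding_def algebra_simps)
  have dim2: "V.dim (UNIV :: 'l set) = 2"
    using assms by (simp add: quadratic_extension_def)
  obtain B where B: "V.independent B" "V.span B = (UNIV :: 'l set)" "card B = 2"
    using V.basis_exists[of UNIV] dim2 by (metis UNIV_I subset_antisym subset_UNIV)
  then obtain u v where uv: "B = {u, v}" "u \<noteq> v"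
    by (auto simp: card_2_iff)
  let ?g = "\<lambda>(a, b). \<iota> a * u + \<iota> b * v"
  have sub: "\<iota> (a - c) = \<iota> a - \<iota> c" for a c
  proof -
    have "\<iota> ((a - c) + c) = \<iota> (a - c) + \<iota> c"
      using emb unfolding field_embedding_def by blast
    then show ?thesis by simp
  qed
  have "inj ?g"
  proof (rule injI, clarify)
    fix a b c d assume eq: "\<iota> a * u + \<iota> b * v = \<iota> c * u + \<iota> d * v"
    let ?h = "\<lambda>w. if w = u then a - c else b - d"
    have "(\<Sum>w\<in>B. \<iota> (?h w) * w) = 0"
      using uv eq by (simp add: sub algebra_simps)
    then have "\<forall>w\<in>B. ?h w = 0"
      using V.independentD[OF B(1), of B ?h] uv by auto
    then show "a = c \<and> b = d" using uv by auto
  qed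
  moreover have "surj ?g"
  proof -
    have "z \<in> range ?g" for z
    proof -
    have "z \<in> V.span {u, v}" using B uv by simp
    then obtain a where "z - \<iota> a * u \<in> V.span {v}"
      by (auto simp: V.span_insert)
    then obtain b where "z - \<iota> a * u = \<iota> b * v"
      by (auto simp: V.span_singleton)
      then show ?thesis
      by (intro image_eqI[of _ _ "(a, b)"]) (simp_all add: algebra_simps)
    qed
    then show ?thesis by blast
  qed
  ultimately have "bij ?g" by (simp add: bij_def)
  then have "CARD('l) = CARD('f \<times> 'f)"
    using bij_betw_same_card by metis
  then show ?thesis by (simp add: power2_eq_square)
qed

lemma quadratic_extension_power_card:
  fixes \<iota> :: "'f::finite_field \<Rightarrow> 'l::finite_field"
  assumes "quadratic_extension \<iota>"
  shows "((z :: 'l) ^ CARD('f)) ^ CARD('f) = z"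
  using finite_field_power_card_eq_same[of z] quadratic_extension_card[OF assms]
  by (simp add: power_mult power2_eq_square)

lemma field_embedding_CHAR:
  fixes \<iota> :: "'f::finite_field \<Rightarrow> 'l::finite_field"
  assumes "field_embedding \<iota>" and "CARD('f) = 2 ^ n"
  shows "CHAR('l) = 2"
proof -
  have "(\<Sum>x\<in>UNIV. x + 1) = (\<Sum>x\<in>UNIV. x :: 'f)"
    by (rule sum.reindex_bij_witness[of _ "\<lambda>x. x - 1" "\<lambda>x. x + 1"]) auto
  then have "of_nat CARD('f) = (0 :: 'f)"
    by (simp add: sum.distrib)
  then have "CHAR('f) dvd 2 ^ n"
    unfolding assms(2) of_nat_eq_0_iff_char_dvd .
  then have "CHAR('f) = 2"
    by (metis CHAR_prime prime_dvd_power primes_dvd_imp_eq two_is_prime_nat)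
  then have "(1 + 1 :: 'f) = 0"
    using of_nat_CHAR[where ?'a = 'f] by simp
  then have "\<iota> (1 + 1) = 0"
    using field_embedding_zero[OF assms(1)] by simp
  moreover have "\<iota> (1 + 1) = 1 + 1"
    using assms(1) unfolding field_embedding_def by metis
  ultimately have "of_nat 2 = (0 :: 'l)" by simp
  then have "CHAR('l) dvd 2"
    by (simp only: of_nat_eq_0_iff_char_dvd)
  then show ?thesis
    by (metis CHAR_prime primes_dvd_imp_eq two_is_prime_nat)
qed

lemma rel_norm_range:
  fixes \<iota> :: "'f::finite_field \<Rightarrow> 'l::finite_field"
  assumes "quadratic_extension \<iota>"
  shows "rel_norm \<iota> z \<in> range \<iota>"
proof (rule field_embedding_range)
  show "field_embedding \<iota>" using assms by (simp add: quadratic_extension_def)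
  show "rel_norm \<iota> z ^ CARD('f) = rel_norm \<iota> z"
    using quadratic_extension_power_card[OF assms, of z]
    by (simp add: rel_norm_def power_mult_distrib mult.commute)
qed

lemma rel_trace_range:
  fixes \<iota> :: "'f::finite_field \<Rightarrow> 'l::finite_field"
  assumes "quadratic_extension \<iota>" and "CARD('f) = 2 ^ n"
  shows "rel_trace \<iota> z \<in> range \<iota>"
proof (rule field_embedding_range)
  show emb: "field_embedding \<iota>" using assms by (simp add: quadratic_extension_def)
  have "prime CHAR('l)" and card: "CARD('f) = CHAR('l) ^ n"
    using field_embedding_CHAR[OF emb assms(2)] assms(2) by simp_all
  from freshmans_dream'[OF this, of z "z ^ CARD('f)"]
  show "rel_trace \<iota> z ^ CARD('f) = rel_trace \<iota> z"
    using quadratic_extension_power_card[OF assms(1), of z]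
    by (simp add: rel_trace_def add.commute)
qed

lemma bessel_real:
  fixes \<iota> :: "'f::finite_field \<Rightarrow> 'l::finite_field"
  assumes "field_embedding \<iota>" and "circle_character \<iota> \<pi>"
  shows "bessel \<iota> \<pi> (\<iota> x) \<in> \<real>"
proof -
  let ?C = "unit_circle \<iota>"
  let ?f = "\<lambda>t. complex_of_real (add_char (inv \<iota> (- rel_trace \<iota> (t * \<iota> x)))) * \<pi> t"
  have C: "t \<in> ?C \<longleftrightarrow> t * t ^ CARD('f) = 1" for t
    by (simp add: unit_circle_def rel_norm_def)
  have inv_in: "inverse t \<in> ?C" if "t \<in> ?C" for t
    using that by (simp add: C power_inverse flip: inverse_mult_distrib)
  have pow: "t ^ CARD('f) = inverse t" if "t \<in> ?C" for t
    using that unfolding C by (metis inverse_unique)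
  have one: "1 \<in> ?C" by (simp add: C)
  have hom: "\<pi> (s * t) = \<pi> s * \<pi> t" and nz: "\<pi> t \<noteq> 0" if "s \<in> ?C" "t \<in> ?C" for s t
    using assms(2) that by (auto simp: circle_character_def)
  have pi1: "\<pi> 1 = 1"
    using hom[OF one one] nz[OF one one] by simp
  have pow_in: "t ^ n \<in> ?C \<and> \<pi> (t ^ n) = \<pi> t ^ n" if "t \<in> ?C" for t n
  proof (induction n)
    case 0
    show ?case using one pi1 by simp
  next
    case (Suc n)
    moreover have "t * t ^ n \<in> ?C"
      using Suc that by (simp only: unit_circle_def rel_norm_def power_mult_distrib mem_Collect_eq mult_1)
    ultimately show ?case using hom[OF that] by simp
  qed
  have cnj_pi: "cnj (\<pi> t) = \<pi> (inverse t)" if t: "t \<in> ?C" for t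
  proof -
    have "t ^ (CARD('f) + 1) = 1" using t by (simp add: C)
    then have "\<pi> t ^ (CARD('f) + 1) = 1" using pow_in[OF t] pi1 by metis
    then have "norm (\<pi> t) ^ (CARD('f) + 1) = 1" by (metis norm_power norm_one)
    then have "norm (\<pi> t) = 1"
      using power_eq_imp_eq_base[of "norm (\<pi> t)" "CARD('f) + 1" 1] by simp
    then have "\<pi> t * cnj (\<pi> t) = 1" by (simp add: complex_norm_square[symmetric])
    moreover have "\<pi> t * \<pi> (inverse t) = 1"
    proof -
      have "t \<noteq> 0" using t by (auto simp: C)
      then show ?thesis using hom[OF t inv_in[OF t]] pi1 by simp
    qed
    ultimately show ?thesis by (metis inverse_unique)
  qed
  have trace: "rel_trace \<iota> (inverse t * \<iota> x) = rel_trace \<iota> (t * \<iota> x)" if t: "t \<in> ?C" for t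
    using pow[OF t] pow[OF inv_in[OF t]] field_embedding_power_card[OF assms(1), of x]
    by (simp add: rel_trace_def power_mult_distrib add.commute)
  have "cnj (\<Sum>t\<in>?C. ?f t) = (\<Sum>t\<in>?C. ?f (inverse t))"
    by (simp add: cnj_pi trace)
  also have "\<dots> = (\<Sum>t\<in>?C. ?f t)"
    by (rule sum.reindex_bij_witness[of _ inverse inverse]) (auto intro: inv_in)
  finally have "(\<Sum>t\<in>?C. ?f t) \<in> \<real>"
    by (simp add: Reals_cnj_iff)
  then show ?thesis
    unfolding bessel_def by (intro Reals_mult) (auto intro: Reals_divide)
qed

end

theory Submission
  imports Defs
begin

text \<open>
  Write \<open>q = CARD('f)\<close>, \<open>C\<close> for the unit circle, \<open>\<chi>\<close>
  for the additive character \<open>add_char\<close> and \<open>J x\<close> for the Bessel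
  function at \<open>x\<close> in the base field. Every inner product of two vectors of
  \<open>Phi\<close> is, up to sign, \<open>0\<close>, \<open>1\<close> or a value of
  \<open>J\<close>, and for a cubic character those values are known exactly.

  Inner products of two Bessel vectors. Because \<open>q\<close> is even, every nonzero element of
  the extension is uniquely \<open>t \<iota>(x)\<close> with \<open>t \<in> C\<close> and
  \<open>x \<noteq> 0\<close> (\<open>polar_decomposition\<close>). Hence a sum over
  \<open>x\<close> of a product of two Bessel functions, each of them a sum over the circle,
  unfolds to a sum over one circle variable \<open>r\<close> of \<open>\<pi> r\<close> times a sum
  over the whole extension of \<open>\<chi>\<close> at a quadratic polynomial
  (\<open>bessel_correlation\<close>). That inner sum is an orthogonality relation when the
  quadratic term vanishes, and otherwise is evaluated by completing the square
  (\<open>sum_add_char_quadratic\<close>). The first case gives the orthonormality of the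
  functions \<open>x \<mapsto> J (y * x)\<close> (\<open>bessel_orthonormal\<close>). The second
  is the finite-field form of Weber's second exponential integral (\<open>weber_integral\<close>):
  twisting by \<open>\<chi> (c * x\<^sup>2)\<close> turns the product of two Bessel functions into
  one value of the Bessel function, up to sign.

  Values of \<open>J\<close> for a cubic character. The weight
  \<open>1 + \<pi> t + (\<pi> t)\<^sup>2\<close> counts the cube roots of \<open>t\<close> on the
  circle (\<open>card_circle_cube_roots\<close>), so \<open>2 * q * J x\<close> is a difference of
  two character sums over \<open>C\<close>, with arguments \<open>x * tr (t ^ 3)\<close> and
  \<open>x * tr t\<close>. Here \<open>tr (t ^ 3) = tr t ^ 3 + tr t\<close>, a Dickson polynomial.
  The traces of elements of \<open>C\<close> together with the elements \<open>v + 1 / v\<close>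
  for nonzero \<open>v\<close> in the base field hit each element of the base field exactly twice
  (\<open>card_trace_fibres\<close>). Over the base field cubing is a bijection, because the
  degree is odd, so the contributions of the \<open>v + 1 / v\<close> cancel, and for
  \<open>x \<noteq> 0\<close> the number \<open>q * J x\<close> is the complete cubic sum of
  \<open>\<chi> (x * (u ^ 3 + u))\<close> (\<open>J_eq_cubic_sum\<close>). Squaring that sum
  leaves only two terms (\<open>cubic_sum_squared\<close>), which give
  \<open>(J (z ^ 3))\<^sup>2 = (1 - \<chi> z) / q\<close> for \<open>z \<noteq> 0\<close>, that is
  \<open>0\<close> or \<open>2 / q\<close>.

  For \<open>q > 2\<close> the number \<open>sqrt (2 / q)\<close> is less than \<open>1\<close>.
  The \<open>q * (q - 1) + (q - 1)\<close> unit vectors of \<open>Phi\<close> therefore span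
  distinct lines, and the coordinate vectors among them span the space.
\<close>

section \<open>The base field and its quadratic extension\<close>

text \<open>
  Odd degree over the prime field matters in two ways: it makes \<open>1\<close> an element of
  absolute trace \<open>1\<close>, and it makes cubing bijective on the base field.
\<close>

locale binary_quadratic_extension =
  fixes \<iota> :: "'f::finite_field \<Rightarrow> 'l::finite_field" and n :: nat
  assumes card_base: "CARD('f) = 2 ^ n"
    and odd_degree: "odd n"
    and quadratic: "quadratic_extension \<iota>"
begin

lemma embedding: "field_embedding \<iota>"
  using quadratic by (simp add: quadratic_extension_def)

lemma iota_simps [simp]:
  "\<iota> 0 = 0" "\<iota> 1 = 1" "\<iota> (x + y) = \<iota> x + \<iota> y" "\<iota> (x * y) = \<iota> x * \<iota> y" "\<iota> (x ^ m) = \<iota> x ^ m"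
  using embedding field_embedding_zero[OF embedding] field_embedding_power[OF embedding]
  by (auto simp: field_embedding_def)

lemma iota_eq_iff [simp]: "\<iota> x = \<iota> y \<longleftrightarrow> x = y"
  using field_embedding_inj[OF embedding] by (simp add: inj_eq)

lemma iota_eq_0_iff [simp]: "\<iota> x = 0 \<longleftrightarrow> x = 0"
  using iota_eq_iff[of x 0] by (simp del: iota_eq_iff)

lemma iota_eq_1_iff [simp]: "\<iota> x = 1 \<longleftrightarrow> x = 1"
  using iota_eq_iff[of x 1] by (simp del: iota_eq_iff)

lemma iota_divide [simp]: "\<iota> (x / y) = \<iota> x / \<iota> y"
proof (cases "y = 0")
  case False
  then have "\<iota> x = \<iota> (x / y) * \<iota> y" by (simp flip: iota_simps(4))
  then show ?thesis using False by (simp add: field_simps)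
qed auto

lemma CHAR_base: "CHAR('f) = 2"
  by (rule field_embedding_CHAR[OF _ card_base, of id]) (simp add: field_embedding_def)

lemma CHAR_ext: "CHAR('l) = 2"
  by (rule field_embedding_CHAR[OF embedding card_base])

lemma double_base [simp]: "x + x = (0::'f)"
  using uminus_CHAR_2[OF CHAR_base, of x] by (metis add.right_inverse)

lemma double_ext [simp]: "z + z = (0::'l)"
  using uminus_CHAR_2[OF CHAR_ext, of z] by (metis add.right_inverse)

lemma add_eq_0_base [simp]: "x + y = (0::'f) \<longleftrightarrow> x = y"
  using uminus_CHAR_2[OF CHAR_base, of y] by (metis add_eq_0_iff2)

lemma add_eq_0_ext [simp]: "z + w = (0::'l) \<longleftrightarrow> z = w"
  using uminus_CHAR_2[OF CHAR_ext, of w] by (metis add_eq_0_iff2)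

lemma power2_add_base: "(x + y)\<^sup>2 = x\<^sup>2 + (y::'f)\<^sup>2"
  by (rule freshmans_dream) (simp_all add: CHAR_base)

lemma power2_add_ext: "(z + w)\<^sup>2 = z\<^sup>2 + (w::'l)\<^sup>2"
  by (rule freshmans_dream) (simp_all add: CHAR_ext)

lemma card_base_gt_1: "CARD('f) > 1"
  using odd_degree one_less_power[of "2::nat" n] by (auto simp: card_base odd_pos)

lemma card_ext: "CARD('l) = CARD('f)\<^sup>2"
  by (rule quadratic_extension_card[OF quadratic])

lemma power2_eq_iff_base [simp]: "x\<^sup>2 = y\<^sup>2 \<longleftrightarrow> x = (y::'f)"
  by (metis power2_add_base add_eq_0_base zero_eq_power2)

lemma power2_eq_iff_ext: "z\<^sup>2 = w\<^sup>2 \<longleftrightarrow> z = (w::'l)"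
  by (metis power2_add_ext add_eq_0_ext zero_eq_power2)

lemma surj_square: "surj (\<lambda>x::'f. x\<^sup>2)"
  by (rule finite_UNIV_inj_surj) (auto intro: injI)

lemma power_2_power_add: "(x + y) ^ (2 ^ i) = x ^ (2 ^ i) + (y::'f) ^ (2 ^ i)"
  by (rule freshmans_dream'[where ?n = i]) (auto simp: CHAR_base)

lemma power_card_add: "(z + w) ^ CARD('f) = z ^ CARD('f) + (w::'l) ^ CARD('f)"
  by (rule freshmans_dream'[where ?n = n]) (auto simp: CHAR_ext card_base)

lemma power_card_power_card [simp]: "((z::'l) ^ CARD('f)) ^ CARD('f) = z"
  by (rule quadratic_extension_power_card[OF quadratic])

lemma iota_power_card [simp]: "\<iota> x ^ CARD('f) = \<iota> x"
  by (rule field_embedding_power_card[OF embedding])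

section \<open>The additive character\<close>

lemma abs_trace_alt: "abs_trace (x::'f) = (\<Sum>i<n. x ^ (2 ^ i))"
proof -
  have "{i. (2::nat) ^ i < 2 ^ n} = {..<n}" by auto
  then show ?thesis by (simp add: abs_trace_def card_base)
qed

lemma abs_trace_add: "abs_trace (x + y) = abs_trace x + abs_trace (y::'f)"
  by (simp add: abs_trace_alt power_2_power_add sum.distrib)

text \<open>
  Squaring shifts the sum of conjugates by one place, and the last conjugate \<open>x ^ q\<close>
  is \<open>x\<close> again.
\<close>

lemma abs_trace_square: "abs_trace (x\<^sup>2) = abs_trace (x::'f)"
proof -
  have "abs_trace (x\<^sup>2) = (\<Sum>i<n. x ^ (2 ^ Suc i))"
    by (simp add: abs_trace_alt power_mult flip: power_mult)
  also have "\<dots> + x = (\<Sum>i<Suc n. x ^ (2 ^ i))"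
    by (subst sum.lessThan_Suc_shift) simp
  also have "\<dots> = abs_trace x + x"
    using finite_field_power_card_eq_same[of x] by (simp add: abs_trace_alt card_base)
  finally show ?thesis by simp
qed

lemma abs_trace_0_1: "abs_trace (x::'f) = 0 \<or> abs_trace x = 1"
proof -
  have "abs_trace x ^ 2 = abs_trace (x\<^sup>2)"
    unfolding abs_trace_alt by (subst freshmans_dream_sum) (simp_all add: CHAR_base mult.commute flip: power_mult)
  then have "abs_trace x ^ 2 = abs_trace x" by (simp add: abs_trace_square)
  then show ?thesis by (auto simp: power2_eq_square)
qed

lemma add_char_add: "add_char (x + y) = add_char x * add_char (y::'f)"
  using abs_trace_0_1[of x] abs_trace_0_1[of y] by (auto simp: add_char_def abs_trace_add)

lemma add_char_square [simp]: "add_char (x\<^sup>2) = add_char (x::'f)"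
  by (simp add: add_char_def abs_trace_square)

lemma add_char_0 [simp]: "add_char (0::'f) = 1"
  using odd_degree by (simp add: add_char_def abs_trace_alt zero_power)

text \<open>
  The trace of \<open>1\<close> is the degree, which is odd. This value shows that
  \<open>\<chi>\<close> is nontrivial, and it decides which of the two possible absolute values a
  cubic Bessel function takes.
\<close>

lemma add_char_1: "add_char (1::'f) = - 1"
proof -
  have "of_nat n = (1::'f)"
    using odd_degree double_base[of 1] by (auto elim!: oddE simp del: double_base)
  then show ?thesis by (simp add: add_char_def abs_trace_alt)
qed

lemma add_char_mult_self [simp]: "add_char x * add_char x = (1::real)"
  by (simp add: add_char_def)

lemma add_char_cases: "add_char (x::'f) = 1 \<or> add_char (x::'f) = - 1"
  by (simp add: add_char_def)

lemma sum_add_char: "(\<Sum>x\<in>UNIV. add_char (a * x)) = (if a = 0 then real CARD('f) else 0)" for a :: 'f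
proof (cases "a = 0")
  case False
  \<comment> \<open>Translation by \<open>1 / a\<close> multiplies each term by the value \<open>-1\<close> at \<open>1\<close>.\<close>
  have "(\<Sum>x\<in>UNIV. add_char (a * x)) = (\<Sum>x\<in>UNIV. add_char (a * (x + 1 / a)))"
    by (rule sum.reindex_bij_witness[of _ "\<lambda>x. x + 1 / a" "\<lambda>x. x - 1 / a"]) auto
  also have "\<dots> = - (\<Sum>x\<in>UNIV. add_char (a * x))"
    using False by (simp add: distrib_left add_char_add add_char_1 sum_negf)
  finally show ?thesis using False by simp
qed auto

lemma sum_add_char_nonzero:
  "(\<Sum>x\<in>UNIV - {0}. add_char (a * x)) = (if a = 0 then real CARD('f) else 0) - 1" for a :: 'f
  using sum_add_char[of a] by (subst sum_diff1) auto

section \<open>Relative trace and norm\<close>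

text \<open>
  The trace and the norm of the extension, with values in the base field itself rather than in its
  image under \<open>\<iota>\<close>.
\<close>

definition tr :: "'l \<Rightarrow> 'f" where
  "tr z = inv \<iota> (rel_trace \<iota> z)"

definition nrm :: "'l \<Rightarrow> 'f" where
  "nrm z = inv \<iota> (rel_norm \<iota> z)"

lemma iota_tr: "\<iota> (tr z) = z + z ^ CARD('f)"
  using f_inv_into_f[OF rel_trace_range[OF quadratic card_base, of z]]
  by (simp add: tr_def rel_trace_def)

lemma iota_nrm: "\<iota> (nrm z) = z * z ^ CARD('f)"
  using f_inv_into_f[OF rel_norm_range[OF quadratic, of z]]
  by (simp add: nrm_def rel_norm_def)

lemma tr_add: "tr (z + w) = tr z + tr w"
  by (subst iota_eq_iff[symmetric]) (simp only: iota_simps iota_tr power_card_add ac_simps)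

lemma tr_iota_mult: "tr (\<iota> x * z) = x * tr z" "tr (z * \<iota> x) = x * tr z"
  by (subst iota_eq_iff[symmetric],
      simp only: iota_simps iota_tr power_mult_distrib iota_power_card distrib_left ac_simps)+

lemma tr_0 [simp]: "tr 0 = 0"
  using tr_iota_mult(1)[of 0 0] by simp

lemma nrm_mult: "nrm (z * w) = nrm z * nrm w"
  by (subst iota_eq_iff[symmetric]) (simp only: iota_simps iota_nrm power_mult_distrib ac_simps)

lemma nrm_iota: "nrm (\<iota> x) = x\<^sup>2"
  by (subst iota_eq_iff[symmetric]) (simp add: iota_nrm power2_eq_square)

lemma nrm_power_card: "nrm (z ^ CARD('f)) = nrm z"
  by (subst iota_eq_iff[symmetric]) (simp add: iota_nrm mult.commute)

lemma nrm_add: "nrm (z + w) = nrm z + nrm w + tr (z * w ^ CARD('f))"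
proof (subst iota_eq_iff[symmetric])
  show "\<iota> (nrm (z + w)) = \<iota> (nrm z + nrm w + tr (z * w ^ CARD('f)))"
    by (simp add: iota_nrm iota_tr power_card_add power_mult_distrib) (simp add: algebra_simps)
qed

lemma nrm_0 [simp]: "nrm 0 = 0"
  using nrm_iota[of 0] by simp

lemma nrm_eq_0_iff [simp]: "nrm z = 0 \<longleftrightarrow> z = 0"
proof -
  have "nrm z = 0 \<longleftrightarrow> \<iota> (nrm z) = 0" by simp
  also have "\<dots> \<longleftrightarrow> z = 0" unfolding iota_nrm by simp
  finally show ?thesis .
qed

section \<open>The unit circle and polar coordinates\<close>

abbreviation "C \<equiv> unit_circle \<iota>"

lemma circle_iff_nrm: "t \<in> C \<longleftrightarrow> nrm t = 1"
proof -
  have "t \<in> C \<longleftrightarrow> \<iota> (nrm t) = 1"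
    by (simp only: unit_circle_def rel_norm_def iota_nrm mem_Collect_eq power_add power_one_right mult.commute)
  then show ?thesis by simp
qed

lemma circle_power_card: "t \<in> C \<Longrightarrow> t ^ CARD('f) = inverse t"
  using iota_nrm[of t] by (simp add: circle_iff_nrm inverse_unique)

lemma circle_1 [simp]: "1 \<in> C"
  using nrm_iota[of 1] by (simp add: circle_iff_nrm)

lemma circle_0 [simp]: "0 \<notin> C"
  using nrm_eq_0_iff[of 0] by (simp add: circle_iff_nrm del: nrm_eq_0_iff)

lemma circle_mult: "s \<in> C \<Longrightarrow> t \<in> C \<Longrightarrow> s * t \<in> C"
  by (simp add: circle_iff_nrm nrm_mult)

lemma circle_power: "t \<in> C \<Longrightarrow> t ^ m \<in> C"
  by (induction m) (auto intro: circle_mult)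

lemma circle_inverse: "t \<in> C \<Longrightarrow> inverse t \<in> C"
  by (metis circle_power circle_power_card)

text \<open>
  On the base field the norm is squaring, which is injective in characteristic two.
\<close>

lemma circle_inter_base: "\<iota> x \<in> C \<longleftrightarrow> x = 1"
  using power2_eq_iff_base[of x 1] by (simp add: circle_iff_nrm nrm_iota)

lemma sum_circle_translate: "s \<in> C \<Longrightarrow> (\<Sum>t\<in>C. g (t * s)) = (\<Sum>t\<in>C. g t)"
  by (rule sum.reindex_bij_witness[of _ "\<lambda>t. t * inverse s" "\<lambda>t. t * s"])
     (auto simp: circle_mult circle_inverse mult.assoc dest: circle_0[THEN contrapos_nn] intro!: right_inverse left_inverse)

lemma sum_circle_inverse: "(\<Sum>t\<in>C. g (inverse t)) = (\<Sum>t\<in>C. g t)"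
  by (rule sum.reindex_bij_witness[of _ inverse inverse]) (auto simp: circle_inverse)

lemma tr_circle: "t \<in> C \<Longrightarrow> \<iota> (tr t) = t + inverse t"
  by (simp add: iota_tr circle_power_card)

lemma tr_inverse: "t \<in> C \<Longrightarrow> tr (inverse t) = tr t"
  by (subst iota_eq_iff[symmetric]) (simp add: tr_circle circle_inverse add.commute)

lemma tr_circle_eq_0_iff: "t \<in> C \<Longrightarrow> tr t = 0 \<longleftrightarrow> t = 1"
proof -
  assume t: "t \<in> C"
  then have "t \<noteq> 0" by auto
  have "tr t = 0 \<longleftrightarrow> \<iota> (tr t) = 0" by simp
  also have "\<dots> \<longleftrightarrow> t\<^sup>2 = 1\<^sup>2"
    using \<open>t \<noteq> 0\<close> by (simp add: tr_circle[OF t] power2_eq_square field_simps)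
  finally show ?thesis by (simp only: power2_eq_iff_ext)
qed

text \<open>
  The modulus of \<open>z\<close> is the unique square root of its norm; dividing by it leaves a
  point of the circle.
\<close>

lemma polar_decomposition:
  "bij_betw (\<lambda>(t, x). t * \<iota> x) (C \<times> (UNIV - {0})) (UNIV - {0})"
proof (rule bij_betwI')
  fix p p' assume "p \<in> C \<times> (UNIV - {0::'f})" "p' \<in> C \<times> (UNIV - {0::'f})"
  then obtain t x t' x' where p: "p = (t, x)" "p' = (t', x')"
    and t: "t \<in> C" "t' \<in> C" and x: "x \<noteq> 0" "x' \<noteq> 0" by auto
  have "x = x'" if "t * \<iota> x = t' * \<iota> x'"
  proof -
    have "nrm (t * \<iota> x) = nrm (t' * \<iota> x')" using that by simp
    then show ?thesis using t by (simp add: nrm_mult nrm_iota circle_iff_nrm)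
  qed
  then show "(case p of (t, x) \<Rightarrow> t * \<iota> x) = (case p' of (t, x) \<Rightarrow> t * \<iota> x) \<longleftrightarrow> p = p'"
    using x by (auto simp: p)
next
  fix z :: 'l assume "z \<in> UNIV - {0}"
  then have z: "z \<noteq> 0" by simp
  obtain x where x: "nrm z = x\<^sup>2" using surj_square by (metis surjD)
  with z have "x \<noteq> 0" by (metis nrm_eq_0_iff zero_power2)
  have "nrm (z / \<iota> x) * nrm (\<iota> x) = nrm z"
    using \<open>x \<noteq> 0\<close> by (simp flip: nrm_mult)
  then have "z / \<iota> x \<in> C" using x \<open>x \<noteq> 0\<close> by (simp add: nrm_iota circle_iff_nrm)
  then show "\<exists>p\<in>C \<times> (UNIV - {0}). z = (case p of (t, x) \<Rightarrow> t * \<iota> x)"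
    using \<open>x \<noteq> 0\<close> by (intro bexI[of _ "(z / \<iota> x, x)"]) auto
next
  fix p assume "p \<in> C \<times> (UNIV - {0::'f})"
  then show "(case p of (t, x) \<Rightarrow> t * \<iota> x) \<in> UNIV - {0}" by auto
qed

lemma sum_polar:
  "(\<Sum>z\<in>UNIV - {0}. g z) = (\<Sum>t\<in>C. \<Sum>x\<in>UNIV - {0}. g (t * \<iota> x))"
  by (subst sum.reindex_bij_betw[OF polar_decomposition, symmetric])
     (simp add: sum.cartesian_product case_prod_unfold)

lemma card_circle: "card C = CARD('f) + 1"
proof -
  have "card C * (CARD('f) - 1) = CARD('l) - 1"
    using bij_betw_same_card[OF polar_decomposition] by (simp add: card_cartesian_product)
  also have "\<dots> = (CARD('f) + 1) * (CARD('f) - 1)"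
    by (simp add: card_ext power2_eq_square algebra_simps)
  finally show ?thesis using card_base_gt_1 by (simp only: mult_cancel2) simp
qed

section \<open>Character sums over the extension\<close>

text \<open>
  In polar coordinates the sum over the modulus is \<open>q - 1\<close> for the direction
  \<open>t = 1\<close>, the only one with trace zero, and \<open>-1\<close> for each of the
  \<open>q\<close> others, so the sum over \<open>z \<noteq> 0\<close> is \<open>-1\<close>. This
  makes the orthogonality relation available without a separate proof that the trace is
  surjective.
\<close>

lemma sum_add_char_tr:
  "(\<Sum>z\<in>UNIV. add_char (tr (z * w))) = (if w = 0 then (real CARD('f))\<^sup>2 else 0)"
proof (cases "w = 0")
  case False
  have "(\<Sum>z\<in>UNIV. add_char (tr (z * w))) = (\<Sum>z\<in>UNIV. add_char (tr z))"
    by (rule sum.reindex_bij_witness[of _ "\<lambda>z. z / w" "\<lambda>z. z * w"]) (use False in auto)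
  also have "\<dots> = 1 + (\<Sum>z\<in>UNIV - {0}. add_char (tr z))"
    by (subst sum.remove[of _ 0]) auto
  also have "(\<Sum>z\<in>UNIV - {0}. add_char (tr z))
      = (\<Sum>t\<in>C. \<Sum>x\<in>UNIV - {0}. add_char (tr t * x))"
    by (simp add: sum_polar tr_iota_mult mult.commute)
  also have "\<dots> = (\<Sum>t\<in>C. (if t = 1 then real CARD('f) else 0) - 1)"
    by (intro sum.cong refl) (simp add: sum_add_char_nonzero tr_circle_eq_0_iff)
  also have "\<dots> = - 1"
    by (simp add: sum_subtractf card_circle)
  finally show ?thesis using False by simp
qed (simp add: card_ext)

text \<open>
  In polar coordinates the norm is the square of the modulus, and \<open>\<chi>\<close> does not
  distinguish an element from its square, so each of the \<open>q + 1\<close> directions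
  contributes a complete linear sum without its term at zero.
\<close>

lemma sum_add_char_nrm:
  assumes "c \<noteq> 0"
  shows "(\<Sum>z\<in>UNIV. add_char (c * nrm z)) = - real CARD('f)"
proof -
  obtain d where d: "c = d\<^sup>2" using surj_square by (metis surjD)
  have sq: "add_char (c * x\<^sup>2) = add_char (d * x)" for x
    using add_char_square[of "d * x"] by (simp add: d power_mult_distrib)
  have "(\<Sum>z\<in>UNIV. add_char (c * nrm z)) = 1 + (\<Sum>z\<in>UNIV - {0}. add_char (c * nrm z))"
    by (subst sum.remove[of _ 0]) auto
  also have "(\<Sum>z\<in>UNIV - {0}. add_char (c * nrm z))
      = (\<Sum>t\<in>C. \<Sum>x\<in>UNIV - {0}. add_char (d * x))"
    by (simp add: sum_polar nrm_mult nrm_iota circle_iff_nrm sq)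
  also have "\<dots> = - real CARD('f) - 1"
    using assms d by (simp add: sum_add_char_nonzero card_circle)
  finally show ?thesis by simp
qed

text \<open>
  Completing the square: the polar form of the norm is \<open>tr (z * w ^ q)\<close>
  (\<open>nrm_add\<close>), so translation of \<open>z\<close> by \<open>v = w ^ q / c\<close>
  absorbs the linear term, at the cost of the constant \<open>c * nrm v = nrm w / c\<close>.
\<close>

lemma sum_add_char_quadratic:
  assumes "c \<noteq> 0"
  shows "(\<Sum>z\<in>UNIV. add_char (c * nrm z + tr (z * w))) = - real CARD('f) * add_char (nrm w / c)"
proof -
  define v where "v = \<iota> (1 / c) * w ^ CARD('f)"
  have v: "v ^ CARD('f) = \<iota> (1 / c) * w"
    by (simp only: v_def power_mult_distrib iota_power_card power_card_power_card)
  have "c * nrm (z + v) = (c * nrm z + tr (z * w)) + nrm w / c" for z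
  proof -
    have "c * nrm v = nrm w / c"
      using assms by (simp only: v_def nrm_mult nrm_iota nrm_power_card) (simp add: power2_eq_square)
    moreover have "c * tr (z * v ^ CARD('f)) = tr (z * w)"
      using assms tr_iota_mult(1)[of "1 / c" "z * w"] by (simp add: v mult.left_commute del: iota_divide)
    ultimately show ?thesis by (simp only: nrm_add distrib_left) (simp only: add_ac)
  qed
  then have "add_char (c * nrm z + tr (z * w)) = add_char (nrm w / c) * add_char (c * nrm (z + v))" for z
    by (simp add: add_char_add)
  then have "(\<Sum>z\<in>UNIV. add_char (c * nrm z + tr (z * w)))
      = add_char (nrm w / c) * (\<Sum>z\<in>UNIV. add_char (c * nrm (z + v)))"
    by (simp add: sum_distrib_left)
  also have "(\<Sum>z\<in>UNIV. add_char (c * nrm (z + v))) = (\<Sum>z\<in>UNIV. add_char (c * nrm z))"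
    by (rule sum.reindex_bij_witness[of _ "\<lambda>z. z - v" "\<lambda>z. z + v"]) auto
  finally show ?thesis using sum_add_char_nrm[OF assms] by simp
qed

end

section \<open>Characters of the circle\<close>

locale circle_char = binary_quadratic_extension \<iota> n
  for \<iota> :: "'f::finite_field \<Rightarrow> 'l::finite_field" and n :: nat +
  fixes \<pi> :: "'l \<Rightarrow> complex"
  assumes character: "circle_character \<iota> \<pi>"
begin

lemma pi_mult: "s \<in> C \<Longrightarrow> t \<in> C \<Longrightarrow> \<pi> (s * t) = \<pi> s * \<pi> t"
  using character by (simp add: circle_character_def)

lemma pi_nonzero: "t \<in> C \<Longrightarrow> \<pi> t \<noteq> 0"
  using character by (simp add: circle_character_def)

lemma pi_1 [simp]: "\<pi> 1 = 1"
  using pi_mult[of 1 1] pi_nonzero[of 1] by simp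

lemma pi_power: "t \<in> C \<Longrightarrow> \<pi> (t ^ m) = \<pi> t ^ m"
  by (induction m) (simp_all add: pi_mult circle_power)

lemma pi_inverse: "t \<in> C \<Longrightarrow> \<pi> t * \<pi> (inverse t) = 1"
  using pi_mult[of t "inverse t"] circle_0 by (cases "t = 0") (auto simp: circle_inverse)

text \<open>
  The order is a least element of a nonempty set of exponents, since \<open>q + 1\<close> is one
  of them.
\<close>

lemma character_order:
  "t \<in> C \<Longrightarrow> \<pi> t ^ character_order \<iota> \<pi> = 1" (is "_ \<Longrightarrow> ?power t")
  "\<lbrakk>0 < m; m < character_order \<iota> \<pi>\<rbrakk> \<Longrightarrow> \<exists>t\<in>C. \<pi> t ^ m \<noteq> 1" (is "\<lbrakk>_; _\<rbrakk> \<Longrightarrow> ?least")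
proof -
  let ?P = "\<lambda>m. 0 < m \<and> (\<forall>t\<in>C. \<pi> t ^ m = 1)"
  have "\<pi> t ^ (CARD('f) + 1) = 1" if "t \<in> C" for t
    using that pi_power[OF that, of "CARD('f) + 1"] by (simp add: unit_circle_def rel_norm_def)
  then have "?P (CARD('f) + 1)" by simp
  then have "?P (character_order \<iota> \<pi>)"
    unfolding character_order_def by (rule LeastI)
  then show "t \<in> C \<Longrightarrow> ?power t" by auto
  show ?least if "0 < m" "m < character_order \<iota> \<pi>"
    using not_less_Least[OF that(2)[unfolded character_order_def]] that(1) by auto
qed

end

section \<open>The Bessel function\<close>

locale bessel_function = circle_char \<iota> n \<pi>
  for \<iota> :: "'f::finite_field \<Rightarrow> 'l::finite_field" and n :: nat and \<pi> :: "'l \<Rightarrow> complex" +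
  assumes nontrivial: "\<exists>t\<in>C. \<pi> t \<noteq> 1"
begin

lemma sum_pi: "(\<Sum>t\<in>C. \<pi> t) = 0"
proof -
  obtain s where s: "s \<in> C" "\<pi> s \<noteq> 1" using nontrivial by auto
  have "(\<Sum>t\<in>C. \<pi> t) = (\<Sum>t\<in>C. \<pi> (t * s))"
    using sum_circle_translate[OF s(1), of \<pi>] by simp
  also have "\<dots> = (\<Sum>t\<in>C. \<pi> t) * \<pi> s"
    using s by (simp add: pi_mult sum_distrib_right)
  finally show ?thesis using s by simp
qed

text \<open>
  Values at base field elements are real by \<open>bessel_real\<close>, so passing to the real
  part is harmless.
\<close>

definition J :: "'f \<Rightarrow> real" where
  "J x = Re (bessel \<iota> \<pi> (\<iota> x))"

lemma J_eq_sum: "of_real (J x) * of_nat CARD('f) = (\<Sum>t\<in>C. of_real (add_char (x * tr t)) * \<pi> t)"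
proof -
  have "inv \<iota> (- rel_trace \<iota> (t * \<iota> x)) = x * tr t" for t
    using tr_iota_mult(2)[of t x] by (simp add: tr_def uminus_CHAR_2[OF CHAR_ext])
  moreover have "of_real (J x) = bessel \<iota> \<pi> (\<iota> x)"
    using bessel_real[OF embedding character] by (simp add: J_def)
  ultimately show ?thesis by (simp add: bessel_def)
qed

text \<open>
  A point of the circle and its inverse have the same trace, so \<open>\<pi>\<close> may be
  replaced by its conjugate.
\<close>

lemma J_eq_sum_inverse:
  "of_real (J x) * of_nat CARD('f) = (\<Sum>t\<in>C. of_real (add_char (x * tr t)) * \<pi> (inverse t))"
  unfolding J_eq_sum by (subst sum_circle_inverse[symmetric]) (simp add: tr_inverse)

text \<open>
  One Bessel function is expanded with \<open>\<pi> s\<close> and the other with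
  \<open>\<pi> (inverse t)\<close>. Putting \<open>s = r * t\<close> leaves the character value
  \<open>\<pi> r\<close>, which no longer depends on \<open>t\<close>. The arguments of
  \<open>\<chi>\<close> depend on \<open>t\<close> and \<open>x\<close> only through
  \<open>z = t * \<iota> x\<close>, and \<open>z\<close> runs through the nonzero elements of the
  extension.
\<close>

lemma bessel_correlation:
  "of_real (\<Sum>x\<in>UNIV - {0}. add_char (c * x\<^sup>2) * J (y * x) * J (y' * x)) * of_nat (CARD('f)\<^sup>2)
   = (\<Sum>r\<in>C. \<pi> r * of_real (\<Sum>z\<in>UNIV - {0}. add_char (c * nrm z + tr (z * (r * \<iota> y + \<iota> y')))))"
proof -
  let ?q = "of_nat CARD('f) :: complex"
  have "of_real (add_char (c * x\<^sup>2) * J (y * x) * J (y' * x)) * ?q\<^sup>2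
      = (\<Sum>r\<in>C. \<Sum>t\<in>C. \<pi> r * of_real (add_char (c * nrm (t * \<iota> x) + tr (t * \<iota> x * (r * \<iota> y + \<iota> y')))))"
    for x
  proof -
    let ?F = "\<lambda>s t. of_real (add_char (c * x\<^sup>2)) * (of_real (add_char (y * x * tr s)) * \<pi> s)
                * (of_real (add_char (y' * x * tr t)) * \<pi> (inverse t)) :: complex"
    have "of_real (add_char (c * x\<^sup>2) * J (y * x) * J (y' * x)) * ?q\<^sup>2
        = of_real (add_char (c * x\<^sup>2)) * (of_real (J (y * x)) * ?q) * (of_real (J (y' * x)) * ?q)"
      by (simp add: power2_eq_square)
    also have "\<dots> = (\<Sum>t\<in>C. \<Sum>s\<in>C. ?F s t)"
      by (simp only: J_eq_sum[of "y * x"] J_eq_sum_inverse[of "y' * x"] sum_distrib_left sum_distrib_right)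
    also have "\<dots> = (\<Sum>t\<in>C. \<Sum>r\<in>C. ?F (r * t) t)"
      by (rule sum.cong[OF refl], rule sum_circle_translate[symmetric])
    also have "\<dots> = (\<Sum>r\<in>C. \<Sum>t\<in>C. ?F (r * t) t)"
      by (rule sum.swap)
    also have "\<dots> = (\<Sum>r\<in>C. \<Sum>t\<in>C. \<pi> r * of_real (add_char (c * nrm (t * \<iota> x) + tr (t * \<iota> x * (r * \<iota> y + \<iota> y')))))"
    proof (intro sum.cong refl)
      fix r t assume rt: "r \<in> C" "t \<in> C"
      have "tr (t * \<iota> x * (r * \<iota> y + \<iota> y')) = tr (\<iota> (y * x) * (r * t)) + tr (\<iota> (y' * x) * t)"
        by (subst tr_add[symmetric]) (simp add: algebra_simps)
      then have "tr (t * \<iota> x * (r * \<iota> y + \<iota> y')) = y * x * tr (r * t) + y' * x * tr t"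
        by (simp only: tr_iota_mult)
      moreover have "nrm (t * \<iota> x) = x\<^sup>2"
        using rt by (simp add: nrm_mult nrm_iota circle_iff_nrm)
      moreover have "\<pi> (r * t) * \<pi> (inverse t) = \<pi> r"
        using rt pi_inverse[of t] by (simp add: pi_mult)
      ultimately show "?F (r * t) t = \<pi> r * of_real (add_char (c * nrm (t * \<iota> x) + tr (t * \<iota> x * (r * \<iota> y + \<iota> y'))))"
        by (simp add: add_char_add)
    qed
    finally show ?thesis .
  qed
  then have "of_real (\<Sum>x\<in>UNIV - {0}. add_char (c * x\<^sup>2) * J (y * x) * J (y' * x)) * ?q\<^sup>2
      = (\<Sum>x\<in>UNIV - {0}. \<Sum>r\<in>C. \<Sum>t\<in>C.
          \<pi> r * of_real (add_char (c * nrm (t * \<iota> x) + tr (t * \<iota> x * (r * \<iota> y + \<iota> y')))))"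
    by (simp only: of_real_sum sum_distrib_right)
  also have "\<dots> = (\<Sum>r\<in>C. \<Sum>x\<in>UNIV - {0}. \<Sum>t\<in>C.
          \<pi> r * of_real (add_char (c * nrm (t * \<iota> x) + tr (t * \<iota> x * (r * \<iota> y + \<iota> y')))))"
    by (rule sum.swap)
  also have "\<dots> = (\<Sum>r\<in>C. \<Sum>t\<in>C. \<Sum>x\<in>UNIV - {0}.
          \<pi> r * of_real (add_char (c * nrm (t * \<iota> x) + tr (t * \<iota> x * (r * \<iota> y + \<iota> y')))))"
    by (intro sum.cong refl sum.swap)
  finally show ?thesis
    by (simp add: sum_polar sum_distrib_left)
qed

text \<open>
  The sum over \<open>z\<close> is \<open>-1\<close> unless
  \<open>r * \<iota> y = \<iota> y'\<close>. In that case \<open>r\<close> lies both on the circle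
  and in the base field, hence is \<open>1\<close>. The terms \<open>-1\<close> cancel because
  \<open>\<pi>\<close> is nontrivial.
\<close>

lemma bessel_orthonormal:
  assumes "y \<noteq> 0" "y' \<noteq> 0"
  shows "(\<Sum>x\<in>UNIV - {0}. J (y * x) * J (y' * x)) = (if y = y' then 1 else 0)"
proof -
  let ?q = "of_nat CARD('f) :: complex"
  have zero: "r * \<iota> y = \<iota> y' \<longleftrightarrow> r = 1 \<and> y = y'" if "r \<in> C" for r
  proof
    assume "r * \<iota> y = \<iota> y'"
    then have "r = \<iota> (y' / y)" using assms by (simp add: field_simps)
    with that have "y' / y = 1" by (metis circle_inter_base)
    then show "r = 1 \<and> y = y'" using \<open>r = \<iota> (y' / y)\<close> assms by auto
  qed auto
  have "of_real (\<Sum>x\<in>UNIV - {0}. J (y * x) * J (y' * x)) * ?q\<^sup>2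
      = (\<Sum>r\<in>C. \<pi> r * of_real (\<Sum>z\<in>UNIV - {0}. add_char (tr (z * (r * \<iota> y + \<iota> y')))))"
    using bessel_correlation[of 0 y y'] by simp
  also have "\<dots> = (\<Sum>r\<in>C. \<pi> r * ((if r = 1 \<and> y = y' then ?q\<^sup>2 else 0) - 1))"
  proof (intro sum.cong refl arg_cong2[where f = "(*)"])
    fix r assume "r \<in> C"
    then show "of_real (\<Sum>z\<in>UNIV - {0}. add_char (tr (z * (r * \<iota> y + \<iota> y'))))
        = (if r = 1 \<and> y = y' then ?q\<^sup>2 else 0) - 1"
      by (subst sum_diff1) (auto simp: sum_add_char_tr zero)
  qed
  also have "\<dots> = (\<Sum>r\<in>C. if r = 1 then (if y = y' then ?q\<^sup>2 else 0) else 0) - (\<Sum>r\<in>C. \<pi> r)"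
    unfolding sum_subtractf[symmetric] by (intro sum.cong refl) (auto simp: algebra_simps)
  also have "\<dots> = of_real (if y = y' then 1 else 0) * ?q\<^sup>2"
    by (simp add: sum_pi)
  finally have "complex_of_real (\<Sum>x\<in>UNIV - {0}. J (y * x) * J (y' * x)) = of_real (if y = y' then 1 else 0)"
    by (subst (asm) mult_cancel_right) simp
  then show ?thesis by (simp only: of_real_eq_iff)
qed

text \<open>
  The Gaussian sum over \<open>z\<close> produces
  \<open>\<chi> (nrm (r * \<iota> y + \<iota> y') / c)\<close>, and the norm expands as
  \<open>y\<^sup>2 + y'\<^sup>2 + y * y' * tr r\<close>. The part containing \<open>tr r\<close>
  makes the sum over \<open>r\<close> a Bessel sum again.
\<close>

lemma weber_integral:
  assumes "c \<noteq> 0"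
  shows "(\<Sum>x\<in>UNIV - {0}. add_char (c * x\<^sup>2) * J (y * x) * J (y' * x))
       = - add_char ((y\<^sup>2 + y'\<^sup>2) / c) * J (y * y' / c)"
proof -
  let ?q = "of_nat CARD('f) :: complex"
  let ?s = "complex_of_real (add_char ((y\<^sup>2 + y'\<^sup>2) / c))"
  have "of_real (\<Sum>x\<in>UNIV - {0}. add_char (c * x\<^sup>2) * J (y * x) * J (y' * x)) * ?q\<^sup>2
      = (\<Sum>r\<in>C. \<pi> r * (- ?q * ?s * of_real (add_char (y * y' / c * tr r)) - 1))"
    unfolding bessel_correlation[unfolded of_nat_power]
  proof (intro sum.cong refl arg_cong2[where f = "(*)"])
    fix r assume r: "r \<in> C"
    have "nrm (r * \<iota> y + \<iota> y') = y\<^sup>2 + y'\<^sup>2 + y * y' * tr r"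
      using r tr_iota_mult(2)[of r "y * y'"]
      by (simp add: nrm_add nrm_mult nrm_iota circle_iff_nrm mult.assoc)
    then have "nrm (r * \<iota> y + \<iota> y') / c = (y\<^sup>2 + y'\<^sup>2) / c + y * y' / c * tr r"
      by (simp add: add_divide_distrib)
    then have "(\<Sum>z\<in>UNIV. add_char (c * nrm z + tr (z * (r * \<iota> y + \<iota> y'))))
        = - real CARD('f) * add_char ((y\<^sup>2 + y'\<^sup>2) / c) * add_char (y * y' / c * tr r)"
      unfolding sum_add_char_quadratic[OF assms] by (simp add: add_char_add)
    then show "of_real (\<Sum>z\<in>UNIV - {0}. add_char (c * nrm z + tr (z * (r * \<iota> y + \<iota> y'))))
        = - ?q * ?s * of_real (add_char (y * y' / c * tr r)) - 1"
      by (subst sum_diff1) simp_all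
  qed
  also have "\<dots> = - ?q * ?s * (\<Sum>r\<in>C. of_real (add_char (y * y' / c * tr r)) * \<pi> r) - (\<Sum>r\<in>C. \<pi> r)"
    unfolding sum_distrib_left sum_subtractf[symmetric] by (intro sum.cong refl) (simp add: algebra_simps)
  also have "\<dots> = of_real (- add_char ((y\<^sup>2 + y'\<^sup>2) / c) * J (y * y' / c)) * ?q\<^sup>2"
    unfolding J_eq_sum[symmetric] by (simp add: sum_pi power2_eq_square[of ?q])
  finally have "complex_of_real (\<Sum>x\<in>UNIV - {0}. add_char (c * x\<^sup>2) * J (y * x) * J (y' * x))
      = of_real (- add_char ((y\<^sup>2 + y'\<^sup>2) / c) * J (y * y' / c))"
    by (subst (asm) mult_cancel_right) simp
  then show ?thesis by (simp only: of_real_eq_iff)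
qed

end

section \<open>Roots, fibres and the Dickson polynomial of degree three\<close>

lemma card_roots_quadratic:
  fixes a :: "'a::idom"
  shows "card {z. z\<^sup>2 + a * z + 1 = 0} \<le> 2" "finite {z. z\<^sup>2 + a * z + 1 = 0}"
proof -
  have "{z. z\<^sup>2 + a * z + 1 = 0} = {z. poly [:1, a, 1:] z = 0}"
    by (auto simp: algebra_simps power2_eq_square)
  then show "card {z. z\<^sup>2 + a * z + 1 = 0} \<le> 2" "finite {z. z\<^sup>2 + a * z + 1 = 0}"
    using card_poly_roots_bound[of "[:1, a, 1:]"] poly_roots_finite[of "[:1, a, 1:]"] by auto
qed

lemma card_cube_roots:
  fixes a :: "'a::idom"
  shows "card {z. z ^ 3 = a} \<le> 3" "finite {z. z ^ 3 = a}"
proof -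
  have "{z. z ^ 3 = a} = {z. poly [:- a, 0, 0, 1:] z = 0}"
    by (auto simp: algebra_simps power3_eq_cube)
  then show "card {z. z ^ 3 = a} \<le> 3" "finite {z. z ^ 3 = a}"
    using card_poly_roots_bound[of "[:- a, 0, 0, 1:]"] poly_roots_finite[of "[:- a, 0, 0, 1:]"] by auto
qed

text \<open>
  In characteristic two, \<open>D(u) = u ^ 3 + u\<close> is the Dickson polynomial with
  \<open>D(w + 1 / w) = w ^ 3 + 1 / w ^ 3\<close>: expanding the left side gives the right side
  plus four times \<open>w + 1 / w\<close>.
\<close>

lemma cube_add_inverse:
  fixes w :: "'a::field"
  assumes "w \<noteq> 0" and "\<And>x::'a. x + x = 0"
  shows "(w + inverse w) ^ 3 + (w + inverse w) = w ^ 3 + inverse (w ^ 3)"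
proof -
  have "(w + inverse w) ^ 3 + (w + inverse w)
      = w ^ 3 + inverse (w ^ 3) + 2 * (w + inverse w) + 2 * (w + inverse w)"
    using assms(1) by (simp add: field_simps eval_nat_numeral)
  then show ?thesis by (simp only: mult_2 assms(2) add_0_right)
qed

text \<open>
  Used to find exact fibre sizes: an upper bound for each fibre, from the degree of a polynomial,
  is an equality as soon as the bounds add up to the right total.
\<close>

lemma sum_eq_imp_eq_of_le:
  fixes f g :: "'a \<Rightarrow> nat"
  assumes "finite A" "\<And>x. x \<in> A \<Longrightarrow> f x \<le> g x" "sum f A = sum g A" "x \<in> A"
  shows "f x = g x"
proof (rule ccontr)
  assume "f x \<noteq> g x"
  then have "f x < g x" using assms by force
  then have "sum f A < sum g A" using assms by (intro sum_strict_mono_ex1) auto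
  then show False using assms by simp
qed

lemma sum_card_fibre:
  fixes h :: "'b \<Rightarrow> 'c::comm_semiring_1"
  assumes "finite A" "finite B" "f ` A \<subseteq> B"
  shows "(\<Sum>x\<in>A. h (f x)) = (\<Sum>y\<in>B. of_nat (card {x \<in> A. f x = y}) * h y)"
proof -
  have "(\<Sum>x\<in>A. h (f x)) = (\<Sum>y\<in>B. \<Sum>x\<in>{x \<in> A. f x = y}. h (f x))"
    by (rule sum.group[symmetric]) (use assms in auto)
  then show ?thesis by simp
qed

section \<open>Cubing on the base field\<close>

context binary_quadratic_extension
begin

text \<open>
  As the degree is odd, \<open>q = 3 * m + 2\<close>; so \<open>v ^ 3 = 1\<close> gives
  \<open>v = v ^ q = v\<^sup>2\<close> and \<open>v = 1\<close>.
\<close>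

lemma cube_inj: "x ^ 3 = y ^ 3 \<Longrightarrow> x = y" for x y :: 'f
proof -
  assume eq: "x ^ 3 = y ^ 3"
  obtain k where n: "n = 2 * k + 1" using odd_degree by (rule oddE)
  have "(4::nat) ^ k mod 3 = 1"
    by (induction k) (simp_all add: mod_mult_right_eq[symmetric] del: mod_mult_right_eq)
  then have "CARD('f) mod 3 = 2"
    unfolding card_base n by (simp add: power_mult) presburger
  then obtain m where m: "CARD('f) = 3 * m + 2"
    by (metis mult_div_mod_eq)
  show "x = y"
  proof (cases "y = 0")
    case False
    define v where "v = x / y"
    have "v ^ 3 = 1" using eq False by (simp add: v_def power_divide)
    then have "v ^ CARD('f) = v\<^sup>2" by (simp add: m power_add power_mult power2_eq_square)
    then have "v = v\<^sup>2" by (simp only: finite_field_power_card_eq_same)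
    moreover have "v \<noteq> 0" using \<open>v ^ 3 = 1\<close> by auto
    ultimately have "v = 1" by (simp add: power2_eq_square)
    then show ?thesis using False by (simp add: v_def)
  qed (use eq in auto)
qed

lemma cube_surj: "\<exists>z. x = z ^ 3" for x :: 'f
proof -
  have "surj (\<lambda>z::'f. z ^ 3)"
    by (rule finite_UNIV_inj_surj) (auto intro: injI cube_inj)
  then show ?thesis by (metis surjD)
qed

lemma sum_cube_nonzero: "(\<Sum>v\<in>UNIV - {0::'f}. g (v ^ 3)) = (\<Sum>v\<in>UNIV - {0}. g v)"
proof (rule sum.reindex_bij_betw)
  show "bij_betw (\<lambda>v::'f. v ^ 3) (UNIV - {0}) (UNIV - {0})"
    unfolding bij_betw_def
  proof
    show "(\<lambda>v::'f. v ^ 3) ` (UNIV - {0}) = UNIV - {0}"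
    proof (intro equalityI subsetI)
      fix x :: 'f assume "x \<in> UNIV - {0}"
      moreover obtain z where "x = z ^ 3" using cube_surj by blast
      ultimately show "x \<in> (\<lambda>v. v ^ 3) ` (UNIV - {0})" by (intro image_eqI[of _ _ z]) auto
    qed auto
  qed (auto intro: inj_onI cube_inj)
qed

section \<open>Traces of circle points and the cubic sum\<close>

text \<open>
  Both fibres consist of solutions of \<open>z\<^sup>2 + u * z + 1 = 0\<close> in the extension,
  and for \<open>u \<noteq> 0\<close> they are disjoint because the circle meets the base field
  only in \<open>1\<close>, whose trace is \<open>0\<close>. So they have at most two elements
  together; for \<open>u = 0\<close> each of them is just \<open>1\<close>. The totals
  \<open>(q + 1) + (q - 1) = 2 * q\<close> force equality.
\<close>

lemma card_trace_fibres:
  "card {t \<in> C. tr t = u} + card {v. v \<noteq> 0 \<and> v + inverse v = u} = 2"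
proof -
  let ?m = "\<lambda>u. card {t \<in> C. tr t = u} + card {v. v \<noteq> 0 \<and> v + inverse v = u}"
  have le: "?m u \<le> 2" for u
  proof (cases "u = 0")
    case True
    have "{t \<in> C. tr t = u} = {1}"
      using True by (auto simp: tr_circle_eq_0_iff)
    moreover have "v + inverse v = 0 \<longleftrightarrow> v = 1" if "v \<noteq> 0" for v :: 'f
    proof -
      have "v + inverse v = 0 \<longleftrightarrow> v\<^sup>2 = 1\<^sup>2"
        using that by (simp add: power2_eq_square field_simps del: power2_eq_iff_base)
      then show ?thesis by (simp only: power2_eq_iff_base)
    qed
    then have "{v::'f. v \<noteq> 0 \<and> v + inverse v = u} = {1}"
      using True by (auto simp del: add_eq_0_base)
    ultimately show ?thesis by simp
  next
    case False
    let ?A = "{t \<in> C. tr t = u}" and ?B = "\<iota> ` {v. v \<noteq> 0 \<and> v + inverse v = u}"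
    let ?R = "{z. z\<^sup>2 + \<iota> u * z + 1 = 0}"
    have root: "z \<in> ?R" if "z \<noteq> 0" "z + inverse z = \<iota> u" for z
    proof -
      have "z\<^sup>2 + \<iota> u * z + 1 = (z\<^sup>2 + 1) + (z\<^sup>2 + 1)"
        using that(1) unfolding that(2)[symmetric] by (simp add: algebra_simps power2_eq_square)
      then show ?thesis by (simp only: double_ext mem_Collect_eq)
    qed
    have A: "?A \<subseteq> ?R"
    proof
      fix t assume t: "t \<in> ?A"
      then have "t \<noteq> 0" by auto
      then show "t \<in> ?R" using t by (intro root) (auto simp: tr_circle[symmetric])
    qed
    have B: "?B \<subseteq> ?R"
    proof (rule image_subsetI)
      fix v assume "v \<in> {v. v \<noteq> 0 \<and> v + inverse v = u}"
      then have "v \<noteq> 0" "u = v + inverse v" by auto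
      then have "\<iota> v + inverse (\<iota> v) = \<iota> u"
        using iota_divide[of 1 v] by (simp add: inverse_eq_divide)
      then show "\<iota> v \<in> ?R"
        using \<open>v \<noteq> 0\<close> by (intro root) auto
    qed
    have "?A \<inter> ?B = {}"
    proof (rule ccontr)
      assume "?A \<inter> ?B \<noteq> {}"
      then obtain v where "\<iota> v \<in> C" "tr (\<iota> v) = u" by auto
      then show False using False tr_circle_eq_0_iff[of 1] by (simp add: circle_inter_base)
    qed
    then have "card ?A + card ?B = card (?A \<union> ?B)"
      by (intro card_Un_disjoint[symmetric]) auto
    also have "\<dots> \<le> card ?R"
      using A B by (intro card_mono card_roots_quadratic(2) Un_least)
    finally have "card ?A + card ?B \<le> card ?R" .
    moreover have "card ?B = card {v. v \<noteq> 0 \<and> v + inverse v = u}"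
      by (intro card_image inj_onI) simp
    ultimately show ?thesis using card_roots_quadratic(1)[of "\<iota> u"] by linarith
  qed
  have "(\<Sum>t\<in>C. 1) = (\<Sum>u\<in>UNIV. card {t \<in> C. tr t = u})"
    using sum_card_fibre[of C UNIV tr "\<lambda>_. 1::nat"] by simp
  moreover have "(\<Sum>v\<in>UNIV - {0::'f}. 1) = (\<Sum>u\<in>UNIV. card {v::'f. v \<noteq> 0 \<and> v + inverse v = u})"
    using sum_card_fibre[of "UNIV - {0::'f}" UNIV "\<lambda>v. v + inverse v" "\<lambda>_. 1::nat"] by simp
  ultimately have "sum ?m UNIV = card C + (CARD('f) - 1)"
    by (simp add: sum.distrib)
  also have "\<dots> = (\<Sum>u\<in>(UNIV :: 'f set). 2)"
    using card_base_gt_1 by (simp add: card_circle)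
  finally show ?thesis
    using le by (intro sum_eq_imp_eq_of_le[of UNIV ?m "\<lambda>_. 2"]) auto
qed

lemma sum_over_traces:
  fixes g :: "'f \<Rightarrow> real"
  shows "2 * (\<Sum>u\<in>UNIV. g u) = (\<Sum>t\<in>C. g (tr t)) + (\<Sum>v\<in>UNIV - {0}. g (v + inverse v))"
proof -
  have "(\<Sum>t\<in>C. g (tr t)) + (\<Sum>v\<in>UNIV - {0}. g (v + inverse v))
     = (\<Sum>u\<in>UNIV. real (card {t \<in> C. tr t = u} + card {v. v \<noteq> 0 \<and> v + inverse v = u}) * g u)"
    using sum_card_fibre[of C UNIV tr g] sum_card_fibre[of "UNIV - {0}" UNIV "\<lambda>v. v + inverse v" g]
    by (simp add: sum.distrib distrib_right)
  also have "\<dots> = 2 * (\<Sum>u\<in>UNIV. g u)"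
    by (simp only: card_trace_fibres sum_distrib_left) simp
  finally show ?thesis by simp
qed

lemma tr_cube: "t \<in> C \<Longrightarrow> tr (t ^ 3) = tr t ^ 3 + tr t"
proof (subst iota_eq_iff[symmetric])
  assume t: "t \<in> C"
  then have "t \<noteq> 0" by auto
  then have "(t + inverse t) ^ 3 + (t + inverse t) = t ^ 3 + inverse (t ^ 3)"
    by (rule cube_add_inverse) (rule double_ext)
  then show "\<iota> (tr (t ^ 3)) = \<iota> (tr t ^ 3 + tr t)"
    using t by (simp only: tr_circle circle_power iota_simps)
qed

definition cubic_sum :: "'f \<Rightarrow> real" where
  "cubic_sum x = (\<Sum>u\<in>UNIV. add_char (x * (u ^ 3 + u)))"

text \<open>
  The identity \<open>sum_over_traces\<close> is applied to
  \<open>\<chi> (x * (u ^ 3 + u))\<close> and to \<open>\<chi> (x * u)\<close>, whose complete sum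
  vanishes. The parts over the base field agree, as \<open>v\<close> may be replaced by
  \<open>v ^ 3\<close> there, and cancel.
\<close>

lemma cubic_sum_eq_circle:
  assumes "x \<noteq> 0"
  shows "2 * cubic_sum x = (\<Sum>t\<in>C. add_char (x * tr (t ^ 3))) - (\<Sum>t\<in>C. add_char (x * tr t))"
proof -
  have cube: "(v + inverse v) ^ 3 + (v + inverse v) = v ^ 3 + inverse (v ^ 3)" if "v \<noteq> 0" for v :: 'f
    using that by (rule cube_add_inverse) (rule double_base)
  have "2 * cubic_sum x = (\<Sum>t\<in>C. add_char (x * tr (t ^ 3)))
      + (\<Sum>v\<in>UNIV - {0}. add_char (x * (v ^ 3 + inverse (v ^ 3))))"
    unfolding cubic_sum_def sum_over_traces
    by (intro arg_cong2[where f = "(+)"] sum.cong refl) (simp_all add: tr_cube cube)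
  also have "(\<Sum>v\<in>UNIV - {0}. add_char (x * (v ^ 3 + inverse (v ^ 3))))
      = (\<Sum>v\<in>UNIV - {0}. add_char (x * (v + inverse v)))"
    by (rule sum_cube_nonzero)
  also have "\<dots> = - (\<Sum>t\<in>C. add_char (x * tr t))"
    using sum_over_traces[of "\<lambda>u. add_char (x * u)"] assms by (simp add: sum_add_char)
  finally show ?thesis by simp
qed

text \<open>
  Weyl differencing. For a fixed difference \<open>w\<close> the exponent is additive in
  \<open>u\<close> apart from a constant, and \<open>\<chi>\<close> does not distinguish an
  element from its square, so the exponent may be written as a multiple of
  \<open>u\<^sup>2\<close>. The sum over \<open>u\<close> then vanishes except when the
  coefficient is zero, which happens for \<open>w = 0\<close> and, since cubing is injective, for
  \<open>w = 1 / z\<close> only. These two values of \<open>w\<close> give the terms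
  \<open>1\<close> and \<open>\<chi> (1 + z\<^sup>2) = - \<chi> z\<close>.
\<close>

lemma cubic_sum_squared:
  assumes "z \<noteq> 0"
  shows "(cubic_sum (z ^ 3))\<^sup>2 = real CARD('f) * (1 - add_char z)"
proof -
  let ?x = "z ^ 3"
  let ?f = "\<lambda>u. ?x * (u ^ 3 + u)"
  have diff: "add_char (?f (u + w)) * add_char (?f u) = add_char (?f w) * add_char ((?x * w + ?x\<^sup>2 * w ^ 4) * u\<^sup>2)"
    for u w
  proof -
    have cube: "(u + w) ^ 3 = u ^ 3 + w ^ 3 + w * u\<^sup>2 + w\<^sup>2 * u"
    proof -
      have "(u + w) ^ 3 = (u + w) * (u + w)\<^sup>2" by (simp add: power3_eq_cube power2_eq_square)
      also have "\<dots> = (u + w) * (u\<^sup>2 + w\<^sup>2)" by (simp only: power2_add_base)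
      finally show ?thesis by (simp add: algebra_simps power3_eq_cube power2_eq_square)
    qed
    have "?f (u + w) = ?f u + (?f w + (?x * w * u\<^sup>2 + ?x * w\<^sup>2 * u))"
      unfolding cube by (simp only: distrib_left mult.assoc) (simp only: add_ac)
    then have "add_char (?f (u + w)) * add_char (?f u)
        = add_char (?f w) * (add_char (?x * w * u\<^sup>2) * add_char (?x * w\<^sup>2 * u))"
      by (simp add: add_char_add)
    also have "add_char (?x * w\<^sup>2 * u) = add_char (?x\<^sup>2 * w ^ 4 * u\<^sup>2)"
      using add_char_square[of "?x * w\<^sup>2 * u"] by (simp add: power_mult_distrib flip: power_mult)
    finally show ?thesis by (simp only: distrib_right add_char_add)
  qed
  have inner: "(\<Sum>u\<in>UNIV. add_char (a * u\<^sup>2)) = (if a = 0 then real CARD('f) else 0)" for a :: 'f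
  proof -
    have "bij (\<lambda>u::'f. u\<^sup>2)" using surj_square by (simp add: bij_def inj_def)
    from sum.reindex_bij_betw[OF this, of "\<lambda>u. add_char (a * u)"] show ?thesis
      by (simp add: sum_add_char)
  qed
  have zeros: "?x * w + ?x\<^sup>2 * w ^ 4 = 0 \<longleftrightarrow> w \<in> {0, inverse z}" for w
  proof (cases "w = 0")
    case False
    have "?x * w + ?x\<^sup>2 * w ^ 4 = ?x * w * (1 + (z * w) ^ 3)"
      by (simp add: algebra_simps power_mult_distrib power2_eq_square eval_nat_numeral)
    then have "?x * w + ?x\<^sup>2 * w ^ 4 = 0 \<longleftrightarrow> (z * w) ^ 3 = 1 ^ 3"
      using False assms by auto
    also have "\<dots> \<longleftrightarrow> z * w = 1" using cube_inj[of "z * w" 1] by auto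
    also have "\<dots> \<longleftrightarrow> w = inverse z" using assms by (auto simp: field_simps)
    finally show ?thesis using False by simp
  qed auto
  have "(cubic_sum ?x)\<^sup>2 = (\<Sum>u\<in>UNIV. \<Sum>v\<in>UNIV. add_char (?f v) * add_char (?f u))"
    by (simp add: cubic_sum_def power2_eq_square sum_product mult.commute)
  also have "\<dots> = (\<Sum>u\<in>UNIV. \<Sum>w\<in>UNIV. add_char (?f (u + w)) * add_char (?f u))"
  proof (rule sum.cong[OF refl])
    fix u show "(\<Sum>v\<in>UNIV. add_char (?f v) * add_char (?f u))
        = (\<Sum>w\<in>UNIV. add_char (?f (u + w)) * add_char (?f u))"
      by (rule sum.reindex_bij_witness[of _ "\<lambda>w. u + w" "\<lambda>v. v - u"]) simp_all
  qed
  also have "\<dots> = (\<Sum>u\<in>UNIV. \<Sum>w\<in>UNIV. add_char (?f w) * add_char ((?x * w + ?x\<^sup>2 * w ^ 4) * u\<^sup>2))"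
    by (simp only: diff)
  also have "\<dots> = (\<Sum>w\<in>UNIV. add_char (?f w) * (\<Sum>u\<in>UNIV. add_char ((?x * w + ?x\<^sup>2 * w ^ 4) * u\<^sup>2)))"
    unfolding sum_distrib_left by (rule sum.swap)
  also have "\<dots> = (\<Sum>w\<in>UNIV. if w \<in> {0, inverse z} then real CARD('f) * add_char (?f w) else 0)"
    unfolding inner zeros by (intro sum.cong refl) simp
  also have "\<dots> = (\<Sum>w\<in>{0, inverse z}. real CARD('f) * add_char (?f w))"
    by (subst sum.inter_restrict[symmetric]) simp_all
  also have "\<dots> = real CARD('f) * (add_char (?f 0) + add_char (?f (inverse z)))"
    using assms by (simp add: distrib_left)
  also have "?f (inverse z) = 1 + z\<^sup>2"
    using assms by (simp add: field_simps eval_nat_numeral)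
  finally show ?thesis by (simp add: add_char_add add_char_1)
qed

end

section \<open>The Bessel function of a cubic character\<close>

locale cubic_bessel_function = bessel_function \<iota> n \<pi>
  for \<iota> :: "'f::finite_field \<Rightarrow> 'l::finite_field" and n :: nat and \<pi> :: "'l \<Rightarrow> complex" +
  assumes pi_cubed: "t \<in> C \<Longrightarrow> \<pi> t ^ 3 = 1"
begin

lemma pi_square: "t \<in> C \<Longrightarrow> (\<pi> t)\<^sup>2 = \<pi> (inverse t)"
proof -
  assume t: "t \<in> C"
  then have "\<pi> t * (\<pi> t)\<^sup>2 = \<pi> t * \<pi> (inverse t)"
    using pi_cubed[OF t] pi_inverse[OF t] by (simp add: power2_eq_square power3_eq_cube mult.assoc)
  then show ?thesis using pi_nonzero[OF t] by simp
qed

text \<open>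
  The right side is \<open>3\<close> on the kernel of \<open>\<pi>\<close> and \<open>0\<close>
  elsewhere. It bounds the number of cube roots, as cubes lie in the kernel and a cubic polynomial
  has at most three roots. Both sides sum to the order of the circle, the right one because
  \<open>\<pi>\<close> and \<open>\<pi>\<^sup>2\<close> are nontrivial; so the bound is attained
  everywhere. This avoids any appeal to the cyclicity of the circle.
\<close>

lemma card_circle_cube_roots:
  assumes "t \<in> C"
  shows "of_nat (card {s \<in> C. s ^ 3 = t}) = 1 + \<pi> t + (\<pi> t)\<^sup>2"
proof -
  let ?m = "\<lambda>t. card {s \<in> C. s ^ 3 = t}" and ?w = "\<lambda>t. if \<pi> t = 1 then 3 else (0::nat)"
  have weight: "of_nat (?w t) = 1 + \<pi> t + (\<pi> t)\<^sup>2" if "t \<in> C" for t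
  proof (cases "\<pi> t = 1")
    case False
    have "(\<pi> t - 1) * (1 + \<pi> t + (\<pi> t)\<^sup>2) = 0"
      using pi_cubed[OF that] by (simp add: algebra_simps power2_eq_square power3_eq_cube)
    with False show ?thesis by simp
  qed simp
  have le: "?m t \<le> ?w t" if "t \<in> C" for t
  proof (cases "\<pi> t = 1")
    case True
    have "?m t \<le> card {z. z ^ 3 = t}"
      by (intro card_mono card_cube_roots(2)) auto
    then show ?thesis using True card_cube_roots(1)[of t] by simp
  next
    case False
    then have "{s \<in> C. s ^ 3 = t} = {}" using pi_power[of _ 3] pi_cubed by auto
    then show ?thesis by (simp only: card.empty)
  qed
  have "(\<Sum>t\<in>C. (\<pi> t)\<^sup>2) = 0"
    using sum_circle_inverse[of \<pi>] sum_pi by (simp add: pi_square)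
  then have "of_nat (sum ?w C) = (of_nat (card C) :: complex)"
    using sum_pi unfolding of_nat_sum by (subst sum.cong[OF refl weight]) (simp_all add: sum.distrib)
  then have "sum ?w C = card C" by (simp only: of_nat_eq_iff)
  also have "card C = sum ?m C"
    using sum_card_fibre[of C C "\<lambda>s. s ^ 3" "\<lambda>_. 1::nat"] by (simp add: image_subset_iff circle_power)
  finally have "?m t = ?w t"
    using le assms by (intro sum_eq_imp_eq_of_le[of C ?m ?w]) auto
  then show ?thesis using weight[OF assms] by simp
qed

text \<open>
  Replacing \<open>t\<close> by \<open>t ^ 3\<close> in a sum over the circle inserts the weight
  \<open>1 + \<pi> t + (\<pi> t)\<^sup>2\<close>. The two nontrivial characters in it are inverse
  to each other and contribute the same multiple of \<open>J x\<close>.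
\<close>

lemma J_eq_cubic_sum:
  assumes "x \<noteq> 0"
  shows "J x * real CARD('f) = cubic_sum x"
proof -
  let ?h = "\<lambda>t. complex_of_real (add_char (x * tr t))"
  have "(\<Sum>t\<in>C. ?h (t ^ 3)) = (\<Sum>t\<in>C. (1 + \<pi> t + (\<pi> t)\<^sup>2) * ?h t)"
    using sum_card_fibre[of C C "\<lambda>s. s ^ 3" ?h] by (simp add: image_subset_iff circle_power card_circle_cube_roots)
  also have "\<dots> = (\<Sum>t\<in>C. ?h t + (?h t * \<pi> t + ?h t * \<pi> (inverse t)))"
    by (intro sum.cong refl) (simp add: pi_square algebra_simps)
  also have "\<dots> = (\<Sum>t\<in>C. ?h t) + 2 * (of_real (J x) * of_nat CARD('f))"
    by (simp only: sum.distrib J_eq_sum[symmetric] J_eq_sum_inverse[symmetric] mult_2)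
  finally have "of_real (2 * (J x * real CARD('f)))
      = complex_of_real ((\<Sum>t\<in>C. add_char (x * tr (t ^ 3))) - (\<Sum>t\<in>C. add_char (x * tr t)))"
    by simp
  then have "2 * (J x * real CARD('f)) = 2 * cubic_sum x"
    unfolding cubic_sum_eq_circle[OF assms] of_real_eq_iff .
  then show ?thesis by simp
qed

lemma J_cube_squared:
  assumes "z \<noteq> 0"
  shows "(J (z ^ 3))\<^sup>2 = (1 - add_char z) / real CARD('f)"
proof -
  have "(J (z ^ 3))\<^sup>2 * (real CARD('f))\<^sup>2 = real CARD('f) * (1 - add_char z)"
    using J_eq_cubic_sum[of "z ^ 3"] cubic_sum_squared[OF assms] assms
    by (simp flip: power_mult_distrib)
  then have "(J (z ^ 3))\<^sup>2 * real CARD('f) = 1 - add_char z"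
    by (simp add: power2_eq_square[of "real CARD('f)"] mult.left_commute)
  then show ?thesis by (simp add: field_simps)
qed

lemma abs_J_cube:
  assumes "z \<noteq> 0"
  shows "\<bar>J (z ^ 3)\<bar> = (if add_char z = 1 then 0 else sqrt (2 / real CARD('f)))"
proof -
  have "\<bar>J (z ^ 3)\<bar> = sqrt ((1 - add_char z) / real CARD('f))"
    by (simp flip: J_cube_squared[OF assms])
  then show ?thesis using add_char_cases[of z] by auto
qed

lemma abs_J_cases:
  assumes "x \<noteq> 0"
  shows "\<bar>J x\<bar> \<in> {0, sqrt (2 / real CARD('f))}"
proof -
  obtain z where z: "x = z ^ 3" using cube_surj by blast
  with assms have "z \<noteq> 0" by auto
  then show ?thesis unfolding z abs_J_cube[OF \<open>z \<noteq> 0\<close>] by simp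
qed

lemma abs_J_1: "\<bar>J 1\<bar> = sqrt (2 / real CARD('f))"
  using abs_J_cube[of 1] by (simp add: add_char_1)

end

section \<open>Lines spanned by unit vectors\<close>

lemma unit_vector_in_span_singleton:
  fixes u v :: "'v::real_inner"
  assumes "u \<in> span {v}" "norm u = 1" "norm v = 1"
  shows "u = v \<or> u = - v"
proof -
  obtain c where c: "u = c *\<^sub>R v" using assms(1) by (auto simp: span_singleton)
  then have "\<bar>c\<bar> = 1" using assms by simp
  then show ?thesis using c by (auto simp: abs_if split: if_splits)
qed

lemma is_line_span_singleton: "v \<noteq> 0 \<Longrightarrow> is_line (span {v})"
  by (simp add: is_line_def dim_insert)

text \<open>
  A family of unit vectors no two of which are parallel: lines correspond to indices, so that
  counting lines and computing angles reduce to the Gram matrix of the family.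
\<close>

context
  fixes v :: "'i \<Rightarrow> 'v::euclidean_space"
  assumes unit: "\<And>i. norm (v i) = 1"
    and separated: "\<And>i j. i \<noteq> j \<Longrightarrow> \<bar>v i \<bullet> v j\<bar> \<noteq> 1"
begin

lemma lines_inj: "inj (\<lambda>i. span {v i})"
proof (rule injI, rule ccontr)
  fix i j assume eq: "span {v i} = span {v j}" and "i \<noteq> j"
  have "v i \<in> span {v j}" unfolding eq[symmetric] by (simp add: span_base)
  then have "v i = v j \<or> v i = - v j"
    by (rule unit_vector_in_span_singleton) (simp_all add: unit)
  then have "\<bar>v i \<bullet> v j\<bar> = 1"
    using unit[of j] by (auto simp: norm_eq_1)
  then show False using separated[OF \<open>i \<noteq> j\<close>] by simp
qed

lemma angle_set_lines: "angle_set (range (\<lambda>i. span {v i})) = {\<bar>v i \<bullet> v j\<bar> | i j. i \<noteq> j}"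
proof (intro equalityI subsetI)
  fix a assume "a \<in> angle_set (range (\<lambda>i. span {v i}))"
  then obtain u w i j where a: "a = \<bar>u \<bullet> w\<bar>" and ne: "span {v i} \<noteq> span {v j}"
    and u: "u \<in> span {v i}" "norm u = 1" and w: "w \<in> span {v j}" "norm w = 1"
    unfolding angle_set_def by blast
  have "i \<noteq> j" using ne by auto
  moreover have "a = \<bar>v i \<bullet> v j\<bar>"
    using unit_vector_in_span_singleton[OF u unit] unit_vector_in_span_singleton[OF w unit] a by auto
  ultimately show "a \<in> {\<bar>v i \<bullet> v j\<bar> | i j. i \<noteq> j}" by blast
next
  fix a assume "a \<in> {\<bar>v i \<bullet> v j\<bar> | i j. i \<noteq> j}"
  then obtain i j where a: "a = \<bar>v i \<bullet> v j\<bar>" and "i \<noteq> j" by blast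
  then have "span {v i} \<noteq> span {v j}" using lines_inj by (auto dest: injD)
  moreover have "v i \<in> span {v i}" "v j \<in> span {v j}" by (simp_all add: span_base)
  ultimately show "a \<in> angle_set (range (\<lambda>i. span {v i}))"
    unfolding angle_set_def using a unit by blast
qed

end

section \<open>The line system of a circle character\<close>

lemma bij_betw_nonzero_val:
  "bij_betw (nonzero_val :: 'a nonzero \<Rightarrow> 'a) UNIV (UNIV - {0::'a::zero_neq_one})"
  by (rule bij_betwI[of _ _ _ Abs_nonzero])
     (use nonzero_val in \<open>auto simp: nonzero_val_inverse Abs_nonzero_inverse\<close>)

lemma card_nonzero: "CARD('a nonzero) = CARD('a::{zero_neq_one,finite}) - 1"
  using bij_betw_same_card[OF bij_betw_nonzero_val[where ?'a = 'a]] by simp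

lemma sum_nonzero_val: "(\<Sum>x\<in>UNIV. g (nonzero_val x)) = (\<Sum>x\<in>UNIV - {0}. g x)"
  by (rule sum.reindex_bij_betw[OF bij_betw_nonzero_val])

lemma nonzero_val_neq_0 [simp]: "nonzero_val x \<noteq> 0"
  using nonzero_val[of x] by simp

context bessel_function
begin

text \<open>
  The vectors of \<open>Phi\<close>, indexed by a type with
  \<open>q * (q - 1) + (q - 1) = q\<^sup>2 - 1\<close> elements.
\<close>

fun frame_vec :: "'f \<times> 'f nonzero + 'f nonzero \<Rightarrow> real ^ 'f nonzero" where
  "frame_vec (Inl (a, y)) = bessel_vec \<iota> \<pi> a y"
| "frame_vec (Inr y) = axis y 1"

lemma Phi_eq_range: "Phi \<iota> \<pi> = range frame_vec"
proof (rule set_eqI)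
  fix v
  have "v \<in> range frame_vec \<longleftrightarrow> (\<exists>a y. v = frame_vec (Inl (a, y))) \<or> (\<exists>y. v = frame_vec (Inr y))"
    by (simp only: image_iff bex_UNIV split_sum_ex split_paired_Ex)
  then show "v \<in> Phi \<iota> \<pi> \<longleftrightarrow> v \<in> range frame_vec"
    by (simp add: Phi_def)
qed

lemma bessel_vec_nth:
  "bessel_vec \<iota> \<pi> a y $ x = add_char (a * (nonzero_val x)\<^sup>2) * J (nonzero_val y * nonzero_val x)"
  unfolding bessel_vec_def J_def nrm_def[symmetric] by (simp add: nrm_iota)

lemma inner_bessel_vec:
  "bessel_vec \<iota> \<pi> a y \<bullet> bessel_vec \<iota> \<pi> b y' =
    (\<Sum>x\<in>UNIV - {0}. add_char ((a + b) * x\<^sup>2) * J (nonzero_val y * x) * J (nonzero_val y' * x))"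
  by (subst sum_nonzero_val[symmetric])
     (simp add: inner_vec_def bessel_vec_nth distrib_right add_char_add ac_simps)

lemma norm_frame_vec: "norm (frame_vec i) = 1"
  by (cases i rule: frame_vec.cases)
     (simp_all add: norm_eq_1 inner_bessel_vec bessel_orthonormal)

lemma abs_inner_frame_vec:
  assumes "i \<noteq> j"
  shows "\<bar>frame_vec i \<bullet> frame_vec j\<bar> \<in> insert 0 ((\<lambda>x. \<bar>J x\<bar>) ` (UNIV - {0}))"
proof -
  have mixed: "\<bar>bessel_vec \<iota> \<pi> a y \<bullet> axis y' 1\<bar> = \<bar>J (nonzero_val y * nonzero_val y')\<bar>" for a y y'
    using add_char_cases[of "a * (nonzero_val y')\<^sup>2"]
    by (auto simp: inner_axis bessel_vec_nth abs_mult)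
  show ?thesis
  proof (cases i rule: frame_vec.cases; cases j rule: frame_vec.cases)
    fix a y b y' assume ij: "i = Inl (a, y)" "j = Inl (b, y')"
    show ?thesis
    proof (cases "a = b")
      case True
      then show ?thesis
        using ij assms by (simp add: inner_bessel_vec bessel_orthonormal nonzero_val_inject)
    next
      case False
      then show ?thesis
        using ij add_char_cases[of "((nonzero_val y)\<^sup>2 + (nonzero_val y')\<^sup>2) / (a + b)"]
        by (auto simp: inner_bessel_vec weber_integral abs_mult)
    qed
  next
    fix a y y' assume "i = Inl (a, y)" "j = Inr y'"
    then show ?thesis by (auto simp: mixed)
  next
    fix y b y' assume "i = Inr y" "j = Inl (b, y')"
    then show ?thesis by (auto simp: mixed inner_commute[of "axis y 1"])
  next
    fix y y' assume "i = Inr y" "j = Inr y'"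
    then show ?thesis using assms by (simp add: inner_axis_axis)
  qed
qed

end

context cubic_bessel_function
begin

text \<open>
  The angle \<open>0\<close> occurs between two coordinate vectors, of which there are at least
  two as \<open>q > 2\<close>. The other angle occurs at \<open>J 1\<close>, because
  \<open>1\<close> is a cube and \<open>\<chi> 1 = -1\<close>.
\<close>

lemma angles_frame_vec:
  assumes "CARD('f) > 2"
  shows "{\<bar>frame_vec i \<bullet> frame_vec j\<bar> | i j. i \<noteq> j} = {0, sqrt (2 / real CARD('f))}"
proof (intro equalityI subsetI)
  fix a assume "a \<in> {\<bar>frame_vec i \<bullet> frame_vec j\<bar> | i j. i \<noteq> j}"
  then obtain i j where a: "a = \<bar>frame_vec i \<bullet> frame_vec j\<bar>" and "i \<noteq> j" by blast
  have "a \<in> insert 0 ((\<lambda>x. \<bar>J x\<bar>) ` (UNIV - {0}))"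
    unfolding a by (rule abs_inner_frame_vec[OF \<open>i \<noteq> j\<close>])
  then show "a \<in> {0, sqrt (2 / real CARD('f))}"
  proof (elim insertE imageE)
    fix x assume "a = \<bar>J x\<bar>" "x \<in> UNIV - {0}"
    then show "a \<in> {0, sqrt (2 / real CARD('f))}" using abs_J_cases[of x] by simp
  qed simp
next
  let ?e = "\<lambda>x :: 'f. frame_vec (Inr (Abs_nonzero x))"
  have "(UNIV :: 'f set) \<noteq> {0, 1}"
  proof
    assume "(UNIV :: 'f set) = {0, 1}"
    then have "CARD('f) = card {0, 1 :: 'f}" by (rule arg_cong)
    then show False using assms by simp
  qed
  then obtain x :: 'f where x: "x \<noteq> 0" "x \<noteq> 1" by blast
  then have ne: "Abs_nonzero x \<noteq> Abs_nonzero 1" by (simp add: Abs_nonzero_inject)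
  then have "\<bar>?e x \<bullet> ?e 1\<bar> = 0" by (simp add: inner_axis_axis)
  then have zero: "0 \<in> {\<bar>frame_vec i \<bullet> frame_vec j\<bar> | i j. i \<noteq> j}"
    using ne by (intro CollectI exI[of _ "Inr (Abs_nonzero x)"] exI[of _ "Inr (Abs_nonzero 1)"]) simp
  have "\<bar>frame_vec (Inl (0, Abs_nonzero 1)) \<bullet> ?e 1\<bar> = sqrt (2 / real CARD('f))"
    by (simp add: inner_axis bessel_vec_nth Abs_nonzero_inverse abs_J_1)
  then have root: "sqrt (2 / real CARD('f)) \<in> {\<bar>frame_vec i \<bullet> frame_vec j\<bar> | i j. i \<noteq> j}"
    by (intro CollectI exI[of _ "Inl (0, Abs_nonzero 1)"] exI[of _ "Inr (Abs_nonzero 1)"]) simp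
  fix a assume "a \<in> {0, sqrt (2 / real CARD('f))}"
  then show "a \<in> {\<bar>frame_vec i \<bullet> frame_vec j\<bar> | i j. i \<noteq> j}"
    by (elim insertE emptyE) (simp_all only: zero root)
qed

end

theorem theorem1:
  fixes \<iota> :: "'f::finite_field \<Rightarrow> 'l::finite_field"
    and \<pi> :: "'l \<Rightarrow> complex"
    and q k :: nat
  assumes "k \<ge> 1"
    and "q = 2 ^ (2 * k + 1)"
    and "CARD('f) = q"
    and "quadratic_extension \<iota>"
    and "circle_character \<iota> \<pi>"
    and "character_order \<iota> \<pi> = 3"
  shows "DIM(real ^ 'f nonzero) = q - 1
    \<and> (\<forall>l\<in>line_system \<iota> \<pi>. is_line l)
    \<and> dim (\<Union> (line_system \<iota> \<pi>)) = q - 1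
    \<and> card (line_system \<iota> \<pi>) = q\<^sup>2 - 1
    \<and> biangular (line_system \<iota> \<pi>)
    \<and> angle_set (line_system \<iota> \<pi>) = {0, sqrt (2 / real q)}"
proof -
  interpret circle_char \<iota> "2 * k + 1" \<pi>
    using assms by unfold_locales auto
  interpret cubic_bessel_function \<iota> "2 * k + 1" \<pi>
    using character_order(1) character_order(2)[of 1] assms(6) by unfold_locales auto
  have "(2::nat) ^ 1 < 2 ^ (2 * k + 1)" using assms(1) by (intro power_strict_increasing) auto
  then have q: "q > 2" using assms(2) by simp
  let ?s = "sqrt (2 / real q)"
  have s: "?s \<noteq> 0" "?s < 1" using q by simp_all
  have angles: "{\<bar>frame_vec i \<bullet> frame_vec j\<bar> | i j. i \<noteq> j} = {0, ?s}"
    using angles_frame_vec q assms(3) by simp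
  have separated: "\<bar>frame_vec i \<bullet> frame_vec j\<bar> \<noteq> 1" if "i \<noteq> j" for i j
    using that angles s by force
  have lines: "line_system \<iota> \<pi> = range (\<lambda>i. span {frame_vec i})"
    by (simp only: line_system_def Phi_eq_range image_image)
  have dim: "DIM(real ^ 'f nonzero) = q - 1"
    using assms(3) by (simp add: card_nonzero)
  have is_lines: "\<forall>l\<in>line_system \<iota> \<pi>. is_line l"
    using norm_frame_vec by (auto simp: lines intro!: is_line_span_singleton) (metis norm_zero zero_neq_one)
  have "(Basis :: (real ^ 'f nonzero) set) \<subseteq> \<Union> (line_system \<iota> \<pi>)"
  proof
    fix b :: "real ^ 'f nonzero" assume "b \<in> Basis"
    then obtain y where "b = frame_vec (Inr y)" by (auto simp: Basis_vec_def)
    then show "b \<in> \<Union> (line_system \<iota> \<pi>)" by (auto simp: lines intro!: exI[of _ "Inr y"] span_base)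
  qed
  then have "span (\<Union> (line_system \<iota> \<pi>)) = UNIV"
    using span_mono span_Basis by blast
  then have "dim (\<Union> (line_system \<iota> \<pi>)) = DIM(real ^ 'f nonzero)"
    by (rule dim_eq_full[THEN iffD2])
  then have dim_union: "dim (\<Union> (line_system \<iota> \<pi>)) = q - 1"
    using dim by (rule trans)
  have "card (line_system \<iota> \<pi>) = CARD('f \<times> 'f nonzero + 'f nonzero)"
    unfolding lines by (rule card_image[OF lines_inj[OF norm_frame_vec separated]])
  also have "\<dots> = q * (q - 1) + (q - 1)"
    using assms(3) by (simp add: card_nonzero)
  also have "\<dots> = q\<^sup>2 - 1"
    using q by (simp add: power2_eq_square algebra_simps)
  finally have card: "card (line_system \<iota> \<pi>) = q\<^sup>2 - 1" .
  have angle_set: "angle_set (line_system \<iota> \<pi>) = {0, ?s}"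
    unfolding lines angles[symmetric] by (rule angle_set_lines[OF norm_frame_vec separated])
  have "biangular (line_system \<iota> \<pi>)"
    using s by (simp add: biangular_def angle_set)
  then show ?thesis using dim is_lines dim_union card angle_set by blast
qed

end
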